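(* Let $k \geq 3$ be an integer with $k \neq 4, 8$. Let $\tau$ be the anyon of type $\frac12$ in the anyon model $\mathbf{SU}(2)_k$, and let $\rho_k \colon B_3 \to U(V^{\tau\tau\tau}_{\tau})$ be the representation of the 3-strand braid group $B_3 = \langle \sigma_1, \sigma_2 \mid \sigma_1\sigma_2\sigma_1 = \sigma_2\sigma_1\sigma_2\rangle$ on the two-dimensional Hilbert space $V^{\tau\tau\tau}_{\tau} \cong \mathbb{C}^2$ (the dense-encoding 1-qubit space) given by braiding. Explicitly, in the orthonormal basis $\{|0\rangle, |1\rangle\}$ of $V^{\tau\tau\tau}_{\tau}$, $\rho_k(\sigma_1) = R$ and $\rho_k(\sigma_2) = F^{-1} R F$, where, with $q^x := e^{2\pi i x/(k+2)}$, $$R = \begin{pmatrix} -q^{-3/4} & 0 \\ 0 & q^{1/4} \end{pmatrix}, \qquad F = \frac{q^{1/2}}{q+1}\begin{pmatrix} -1 & \sqrt{q + q^{-1} + 1} \\ \sqrt{q+q^{-1}+1} & 1 \end{pmatrix}.$$ Then $\rho_k(\sigma_1^2)$ and $\rho_k(\sigma_2^2)$, together with the scalar matrices $\{\lambda I : \lambda \in \mathbb{C}, |\lambda| = 1\}$, generate a dense subgroup of $U(V^{\tau\tau\tau}_{\tau}) \cong U(2)$.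
   Context: Notation: $q = e^{2\pi i/(k+2)}$, and fractional powers are always taken as $q^x = e^{2\pi i x/(k+2)}$ for real $x$. The number $q + q^{-1} + 1 = 1 + 2\cos\frac{2\pi}{k+2}$ is a positive real for $k \ge 3$, and $\sqrt{q+q^{-1}+1}$ denotes its positive square root. Also $\frac{q^{1/2}}{q+1} = \frac{1}{2\cos(\pi/(k+2))}$, so $F$ is a real symmetric matrix with $F^2 = I$. Origin of the representation: $\mathbf{SU}(2)_k$ is the unitary modular tensor category of the $SU(2)$ Witten-Chern-Simons theory at level $k$, with simple objects (anyon types) $0, \frac12, 1, \dots, \frac{k}{2}$. The space $V^{\tau\tau\tau}_{\tau}$ is the space of states of three anyons of type $\tau = \frac12$ with total type $\tau$. It is two-dimensional, with orthonormal basis $|x\rangle$, $x \in \{0,1\}$, where $x$ is the total type of the first two anyons. The generator $\sigma_i$ acts by the counterclockwise exchange of the $i$-th and $(i+1)$-th anyons. The diagonal entries of $R$ are the braiding phases ($R$-symbols) $R^{\tau\tau}_0, R^{\tau\tau}_1$, and $F = F^{\tau\tau\tau}_{\tau}$ is the change-of-basis matrix ($F$-symbols) between the two ways of associating the three anyons. For the purposes of the statement, $\rho_k$ is fully specified by the explicit matrices for $\rho_k(\sigma_1)$ and $\rho_k(\sigma_2)$ given in the claim, and these satisfy the braid relation. The elements $\sigma_1^2, \sigma_2^2$ are called double-braidings. Dense means dense in the usual topology of the unitary group $U(2)$. *)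

theory Defs
  imports "HOL-Analysis.Analysis" "HOL-Algebra.Generated_Groups"
begin

section \<open>The braid group on three strands\<close>

datatype braid_gen = S1 | S2

text \<open>A word is a list of letters; the letter \<open>(g, True)\<close> stands for the generator \<open>g\<close>
  and \<open>(g, False)\<close> for its inverse.\<close>

type_synonym braid_word = "(braid_gen \<times> bool) list"

text \<open>The congruence on words generated by free cancellation and the braid relation.\<close>

inductive braid_eq :: "braid_word \<Rightarrow> braid_word \<Rightarrow> bool" where
  refl: "braid_eq u u"
| sym: "braid_eq u v \<Longrightarrow> braid_eq v u"
| trans: "braid_eq u v \<Longrightarrow> braid_eq v w \<Longrightarrow> braid_eq u w"
| append: "braid_eq u v \<Longrightarrow> braid_eq u' v' \<Longrightarrow> braid_eq (u @ u') (v @ v')"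
| cancel: "braid_eq [(g, e), (g, \<not> e)] []"
| braid: "braid_eq [(S1, True), (S2, True), (S1, True)] [(S2, True), (S1, True), (S2, True)]"

quotient_type braid3 = braid_word / braid_eq
  by (rule equivpI; auto simp: reflp_def symp_def transp_def
        intro: braid_eq.refl braid_eq.sym braid_eq.trans)

lift_definition braid3_mult :: "braid3 \<Rightarrow> braid3 \<Rightarrow> braid3" is append
  by (rule braid_eq.append)

lift_definition braid3_one :: braid3 is "[]" .

lift_definition \<sigma>1 :: braid3 is "[(S1, True)]" .

lift_definition \<sigma>2 :: braid3 is "[(S2, True)]" .

definition B3 :: "braid3 monoid" where
  "B3 = \<lparr>carrier = UNIV, mult = braid3_mult, one = braid3_one\<rparr>"

definition word_inv :: "braid_word \<Rightarrow> braid_word" where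
  "word_inv w = rev (map (\<lambda>(g, e). (g, \<not> e)) w)"

lemma word_inv_left: "braid_eq (word_inv w @ w) []"
proof (induction w)
  case Nil
  then show ?case by (simp add: word_inv_def braid_eq.refl)
next
  case (Cons l w)
  obtain g e where l: "l = (g, e)" by (cases l)
  have "braid_eq [(g, \<not> e), (g, e)] []"
    using braid_eq.cancel[of g "\<not> e"] by simp
  then have "braid_eq ([(g, \<not> e), (g, e)] @ w) ([] @ w)"
    by (rule braid_eq.append) (rule braid_eq.refl)
  then have "braid_eq (word_inv w @ ([(g, \<not> e), (g, e)] @ w)) (word_inv w @ ([] @ w))"
    by (rule braid_eq.append[OF braid_eq.refl])
  then show ?case
    using Cons.IH l braid_eq.trans by (simp add: word_inv_def)
qed

lemma group_B3: "group B3"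
proof (rule groupI)
  fix x y z assume "x \<in> carrier B3" "y \<in> carrier B3" "z \<in> carrier B3"
  show "x \<otimes>\<^bsub>B3\<^esub> y \<otimes>\<^bsub>B3\<^esub> z = x \<otimes>\<^bsub>B3\<^esub> (y \<otimes>\<^bsub>B3\<^esub> z)"
    unfolding B3_def monoid.simps partial_object.simps
    by transfer (simp add: braid_eq.refl)
next
  fix x assume "x \<in> carrier B3"
  show "\<one>\<^bsub>B3\<^esub> \<otimes>\<^bsub>B3\<^esub> x = x"
    unfolding B3_def monoid.simps partial_object.simps
    by transfer (simp add: braid_eq.refl)
next
  fix x assume "x \<in> carrier B3"
  have "\<exists>y. braid3_mult y x = braid3_one"
    by transfer (use word_inv_left in blast)
  then show "\<exists>y\<in>carrier B3. y \<otimes>\<^bsub>B3\<^esub> x = \<one>\<^bsub>B3\<^esub>"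
    by (simp add: B3_def)
qed (simp_all add: B3_def)

lemma B3_braid_relation:
  "\<sigma>1 \<otimes>\<^bsub>B3\<^esub> \<sigma>2 \<otimes>\<^bsub>B3\<^esub> \<sigma>1 = \<sigma>2 \<otimes>\<^bsub>B3\<^esub> \<sigma>1 \<otimes>\<^bsub>B3\<^esub> \<sigma>2"
  unfolding B3_def monoid.simps partial_object.simps
  by transfer (simp add: braid_eq.braid)

text \<open>The universal property of the presentation.\<close>

lemma B3_hom_exists:
  fixes G (structure)
  assumes "group G" and a: "a \<in> carrier G" and b: "b \<in> carrier G"
    and ab: "a \<otimes> b \<otimes> a = b \<otimes> a \<otimes> b"
  shows "\<exists>h \<in> hom B3 G. h \<sigma>1 = a \<and> h \<sigma>2 = b"
proof -
  interpret group G by fact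
  define l where "l = (\<lambda>(g, e). let x = (case g of S1 \<Rightarrow> a | S2 \<Rightarrow> b) in if e then x else inv x)"
  define ev where "ev = (\<lambda>w. foldr (\<lambda>p x. l p \<otimes> x) w \<one>)"
  have l: "l p \<in> carrier G" for p
    using a b by (auto simp: l_def Let_def split: braid_gen.splits prod.splits)
  have ev_simps: "ev [] = \<one>" "ev (p # w) = l p \<otimes> ev w" for p w
    by (simp_all add: ev_def)
  have ev_closed: "ev w \<in> carrier G" for w
    by (induction w) (use l in \<open>simp_all add: ev_simps\<close>)
  have ev_append: "ev (u @ v) = ev u \<otimes> ev v" for u v
    by (induction u) (use l ev_closed in \<open>simp_all add: ev_simps m_assoc\<close>)
  have ev_cong: "ev u = ev v" if "braid_eq u v" for u v
    using that
  proof induction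
    case (cancel g e)
    then show ?case
      using a b by (cases g; cases e) (simp_all add: ev_simps l_def)
  next
    case braid
    then show ?case
      using ab a b by (simp add: ev_simps l_def m_assoc)
  qed (simp_all add: ev_append)
  define h where "h = (\<lambda>x. ev (rep_braid3 x))"
  have h: "h (abs_braid3 w) = ev w" for w
    unfolding h_def by (rule ev_cong) (rule rep_abs_rsp_left[OF Quotient3_braid3 braid_eq.refl])
  have "h \<in> hom B3 G"
  proof (rule homI)
    fix x y assume "x \<in> carrier B3" "y \<in> carrier B3"
    obtain u v where "x = abs_braid3 u" "y = abs_braid3 v"
      by (metis Quotient3_abs_rep Quotient3_braid3)
    then show "h (x \<otimes>\<^bsub>B3\<^esub> y) = h x \<otimes> h y"
      by (simp add: B3_def braid3_mult.abs_eq h ev_append)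
  qed (simp add: h_def ev_closed)
  moreover have "h \<sigma>1 = a" "h \<sigma>2 = b"
    using a b by (simp_all add: \<sigma>1_def \<sigma>2_def h ev_simps l_def)
  ultimately show ?thesis by blast
qed


section \<open>The unitary group\<close>

definition conj_transpose :: "complex ^ 'n ^ 'n \<Rightarrow> complex ^ 'n ^ 'n" where
  "conj_transpose A = (\<chi> i j. cnj (A $ j $ i))"

definition unitary_matrix :: "complex ^ 'n ^ 'n \<Rightarrow> bool" where
  "unitary_matrix A \<longleftrightarrow> conj_transpose A ** A = mat 1 \<and> A ** conj_transpose A = mat 1"

definition U2 :: "(complex ^ 2 ^ 2) monoid" where
  "U2 = \<lparr>carrier = {A. unitary_matrix A}, mult = (**), one = mat 1\<rparr>"

lemma conj_transpose_mult: "conj_transpose (A ** B) = conj_transpose B ** conj_transpose A"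
  by (simp add: conj_transpose_def matrix_matrix_mult_def vec_eq_iff mult.commute)

lemma conj_transpose_conj_transpose: "conj_transpose (conj_transpose A) = A"
  by (simp add: conj_transpose_def vec_eq_iff)

lemma conj_transpose_one: "conj_transpose (mat 1) = mat 1"
  by (simp add: conj_transpose_def mat_def vec_eq_iff)

lemma unitary_matrix_mult:
  assumes "unitary_matrix A" "unitary_matrix B"
  shows "unitary_matrix (A ** B)"
proof -
  have "conj_transpose B ** conj_transpose A ** (A ** B) = 
      conj_transpose B ** (conj_transpose A ** A) ** B"
    and "A ** B ** (conj_transpose B ** conj_transpose A) =
      A ** (B ** conj_transpose B) ** conj_transpose A"
    by (simp_all only: matrix_mul_assoc)
  then show ?thesis
    using assms by (simp add: unitary_matrix_def conj_transpose_mult)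
qed

lemma group_U2: "group U2"
proof (rule groupI)
  fix A assume "A \<in> carrier U2"
  then show "\<exists>B\<in>carrier U2. B \<otimes>\<^bsub>U2\<^esub> A = \<one>\<^bsub>U2\<^esub>"
    by (intro bexI[of _ "conj_transpose A"])
      (simp_all add: U2_def unitary_matrix_def conj_transpose_conj_transpose)
qed (simp_all add: U2_def unitary_matrix_mult matrix_mul_assoc,
     simp add: unitary_matrix_def conj_transpose_one)


section \<open>The braiding matrices\<close>

text \<open>The power \<open>q\<^sup>x = exp (2 \<pi> i x / (k + 2))\<close> of \<open>q = exp (2 \<pi> i / (k + 2))\<close>.\<close>

definition qpow :: "nat \<Rightarrow> real \<Rightarrow> complex" where
  "qpow k x = exp (2 * of_real pi * \<i> * of_real x / (of_nat k + 2))"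

definition R_matrix :: "nat \<Rightarrow> complex ^ 2 ^ 2" where
  "R_matrix k = vector [vector [- qpow k (- 3 / 4), 0],
                        vector [0, qpow k (1 / 4)]]"

text \<open>Multiplying by \<open>mat c\<close> is scalar multiplication by \<open>c\<close>. The argument of the square root is a
  positive real number for \<open>k \<ge> 3\<close> (see below), where \<open>csqrt\<close> is the positive square root.\<close>

definition F_matrix :: "nat \<Rightarrow> complex ^ 2 ^ 2" where
  "F_matrix k =
     (let s = csqrt (qpow k 1 + qpow k (- 1) + 1)
      in mat (qpow k (1 / 2) / (qpow k 1 + 1)) ** vector [vector [- 1, s], vector [s, 1]])"

lemma qpow_cis: "qpow k x = cis (2 * pi * x / (real k + 2))"
  by (simp add: qpow_def cis_conv_exp mult_ac)

lemma qpow_add: "qpow k (x + y) = qpow k x * qpow k y"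
  by (simp add: qpow_cis cis_mult add_divide_distrib distrib_left)

lemma F_sqrt_arg:
  "qpow k 1 + qpow k (- 1) + 1 = of_real (1 + 2 * cos (2 * pi / (real k + 2)))"
  by (simp add: qpow_cis complex_eq_iff)

lemma F_sqrt_arg_pos:
  assumes "k \<ge> 3"
  shows "1 + 2 * cos (2 * pi / (real k + 2)) > 0"
proof -
  have "cos (2 * pi / (real k + 2)) > cos (pi / 2)"
    using assms pi_gt_zero by (intro cos_monotone_0_pi) (auto simp: field_simps)
  then show ?thesis by simp
qed

lemma F_coeff: "qpow k (1 / 2) / (qpow k 1 + 1) = of_real (1 / (2 * cos (pi / (real k + 2))))"
proof -
  have "qpow k 1 + 1 = qpow k (1 / 2) * (qpow k (1 / 2) + qpow k (- 1 / 2))"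
    by (simp add: distrib_left flip: qpow_add) (simp add: qpow_cis)
  moreover have "qpow k (1 / 2) + qpow k (- 1 / 2) = of_real (2 * cos (pi / (real k + 2)))"
    by (simp add: qpow_cis complex_eq_iff)
  moreover have "qpow k (1 / 2) \<noteq> 0"
    by (simp add: qpow_cis)
  ultimately show ?thesis by simp
qed

text \<open>The two matrices satisfy the braid relation, so they do define a representation of \<open>B3\<close>
  by unitary matrices (\<open>braid_representation_exists\<close> below).\<close>

lemma F_matrix_real:
  fixes k :: nat
  defines "c \<equiv> 1 / (2 * cos (pi / (real k + 2)))"
  defines "s \<equiv> sqrt (1 + 2 * cos (2 * pi / (real k + 2))) * c"
  assumes k: "k \<ge> 3"
  shows "F_matrix k = vector [vector [of_real (- c), of_real s], vector [of_real s, of_real c]]"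
    and "c\<^sup>2 + s\<^sup>2 = 1" and "c \<noteq> 0"
proof -
  have cpos: "cos (pi / (real k + 2)) > 0"
    using k pi_gt_zero by (intro cos_gt_zero) (auto simp: field_simps)
  then show "c \<noteq> 0" by (simp add: c_def)
  have pos: "1 + 2 * cos (2 * pi / (real k + 2)) > 0"
    using F_sqrt_arg_pos[OF k] .
  have root: "csqrt (qpow k 1 + qpow k (- 1) + 1) = 
      of_real (sqrt (1 + 2 * cos (2 * pi / (real k + 2))))"
    unfolding F_sqrt_arg using pos by (subst csqrt_of_real_nonneg) auto
  show "F_matrix k = vector [vector [of_real (- c), of_real s], vector [of_real s, of_real c]]"
    unfolding F_matrix_def Let_def root F_coeff
    by (simp add: vec_eq_iff forall_2 matrix_matrix_mult_def sum_2 mat_def c_def s_def)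
  have "cos (2 * pi / (real k + 2)) = 2 * (cos (pi / (real k + 2)))\<^sup>2 - 1"
    using cos_double_cos[of "pi / (real k + 2)"] by simp
  then have "1 + s\<^sup>2 / c\<^sup>2 = 1 / c\<^sup>2"
    using pos cpos by (simp add: s_def c_def power_mult_distrib power_divide)
  then show "c\<^sup>2 + s\<^sup>2 = 1"
    using \<open>c \<noteq> 0\<close> by (simp add: field_simps)
qed

lemma diag_braid_relation:
  fixes a b c s :: complex
  defines "A \<equiv> (vector [vector [a, 0], vector [0, b]] :: complex ^ 2 ^ 2)"
  defines "F \<equiv> (vector [vector [- c, s], vector [s, c]] :: complex ^ 2 ^ 2)"
  assumes cs: "c\<^sup>2 + s\<^sup>2 = 1" and ab: "c\<^sup>2 * (a - b)\<^sup>2 + a * b = 0"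
  shows "A ** (F ** A ** F) ** A = (F ** A ** F) ** A ** (F ** A ** F)"
proof -
  define x y z where "x = c\<^sup>2 * a + s\<^sup>2 * b" and "y = c * s * (b - a)" and "z = s\<^sup>2 * a + c\<^sup>2 * b"
  have B: "F ** A ** F = vector [vector [x, y], vector [y, z]]"
    by (simp add: A_def F_def x_def y_def z_def vec_eq_iff forall_2 matrix_matrix_mult_def sum_2
        power2_eq_square algebra_simps)
  have "x + z = (c\<^sup>2 + s\<^sup>2) * (a + b)"
    by (simp add: x_def z_def algebra_simps)
  then have xz: "z = a + b - x"
    using cs by (simp add: algebra_simps)
  have "x = c\<^sup>2 * (a - b) + (c\<^sup>2 + s\<^sup>2) * b"
    by (simp add: x_def algebra_simps)
  then have "x = c\<^sup>2 * (a - b) + b"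
    by (simp add: cs)
  then have "x * (a - b) = c\<^sup>2 * (a - b)\<^sup>2 + a * b - b\<^sup>2"
    by (simp only:) (simp add: power2_eq_square algebra_simps)
  then have x: "x * (a - b) = - b\<^sup>2"
    using ab by simp
  have "x * z - y\<^sup>2 = (c\<^sup>2 + s\<^sup>2)\<^sup>2 * (a * b)"
    by (simp add: x_def y_def z_def power2_eq_square algebra_simps)
  then have y: "y\<^sup>2 = x * z - a * b"
    using cs by (simp add: algebra_simps)
  have "a * a * x = a * x\<^sup>2 + b * y\<^sup>2" "b * b * z = a * y\<^sup>2 + b * z\<^sup>2"
      "a * b * y = (a * x + b * z) * y"
    using x unfolding y xz by algebra+
  then show ?thesis
    unfolding B by (simp add: A_def vec_eq_iff forall_2 matrix_matrix_mult_def sum_2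
        power2_eq_square algebra_simps)
qed

lemma braid_representation_exists:
  assumes k: "k \<ge> 3"
  shows "\<exists>\<rho> \<in> hom B3 U2. \<rho> \<sigma>1 = R_matrix k \<and>
    \<rho> \<sigma>2 = matrix_inv (F_matrix k) ** R_matrix k ** F_matrix k"
proof (rule B3_hom_exists[OF group_U2])
  define c where "c = 1 / (2 * cos (pi / (real k + 2)))"
  define s where "s = sqrt (1 + 2 * cos (2 * pi / (real k + 2))) * c"
  note F = F_matrix_real[OF k, folded c_def, folded s_def]
  have cs: "(of_real c)\<^sup>2 + (of_real s)\<^sup>2 = (1 :: complex)"
    using arg_cong[OF F(2), of complex_of_real] by simp
  have FF: "F_matrix k ** F_matrix k = mat 1"
    using cs by (simp add: F(1) vec_eq_iff forall_2 matrix_matrix_mult_def sum_2 mat_def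
        power2_eq_square add.commute)
  then have "\<exists>X. F_matrix k ** X = mat 1 \<and> X ** F_matrix k = mat 1"
    by blast
  then have "F_matrix k ** matrix_inv (F_matrix k) = mat 1 \<and>
      matrix_inv (F_matrix k) ** F_matrix k = mat 1"
    unfolding matrix_inv_def by (rule someI_ex)
  then have "F_matrix k ** (F_matrix k ** matrix_inv (F_matrix k)) = F_matrix k"
    by (simp only: matrix_mul_rid)
  then have Finv: "matrix_inv (F_matrix k) = F_matrix k"
    by (simp only: matrix_mul_assoc FF matrix_mul_lid)
  have "conj_transpose (F_matrix k) = F_matrix k"
    by (simp add: F(1) conj_transpose_def vec_eq_iff forall_2)
  then have uF: "unitary_matrix (F_matrix k)"
    using FF by (simp add: unitary_matrix_def)
  have uR: "unitary_matrix (R_matrix k)"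
    by (simp add: unitary_matrix_def R_matrix_def qpow_cis conj_transpose_def vec_eq_iff forall_2
        matrix_matrix_mult_def sum_2 mat_def cis_cnj cis_mult)
  show "R_matrix k \<in> carrier U2"
    "matrix_inv (F_matrix k) ** R_matrix k ** F_matrix k \<in> carrier U2"
    using uF uR by (simp_all add: U2_def Finv unitary_matrix_mult)
  define a b where "a = - qpow k (- 3 / 4)" and "b = qpow k (1 / 4)"
  have "qpow k (1 / 2) + qpow k (- 1 / 2) = of_real (1 / c)"
    by (simp add: qpow_cis complex_eq_iff c_def)
  then have c: "of_real c * (qpow k (1 / 2) + qpow k (- 1 / 2)) = 1"
    using F(3) by simp
  have "a - b = - (qpow k (- 1 / 4) * (qpow k (1 / 2) + qpow k (- 1 / 2)))"
    by (simp add: a_def b_def distrib_left flip: qpow_add)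
  then have "of_real c * (a - b) =
      - (qpow k (- 1 / 4) * (of_real c * (qpow k (1 / 2) + qpow k (- 1 / 2))))"
    by (simp only: mult_minus_right mult.left_commute)
  then have "of_real c * (a - b) = - (qpow k (- 1 / 4))"
    by (simp only: c mult_1_right)
  then have "(of_real c)\<^sup>2 * (a - b)\<^sup>2 = (qpow k (- 1 / 4))\<^sup>2"
    by (simp flip: power_mult_distrib)
  then have ab: "(of_real c)\<^sup>2 * (a - b)\<^sup>2 + a * b = 0"
    by (simp add: a_def b_def power2_eq_square flip: qpow_add)
  show "R_matrix k \<otimes>\<^bsub>U2\<^esub> (matrix_inv (F_matrix k) ** R_matrix k ** F_matrix k) \<otimes>\<^bsub>U2\<^esub> R_matrix k =
    matrix_inv (F_matrix k) ** R_matrix k ** F_matrix k \<otimes>\<^bsub>U2\<^esub> R_matrix k \<otimes>\<^bsub>U2\<^esub>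
      (matrix_inv (F_matrix k) ** R_matrix k ** F_matrix k)"
    using diag_braid_relation[OF cs ab]
    unfolding U2_def monoid.simps Finv unfolding F(1) R_matrix_def a_def b_def
    by (simp add: matrix_mul_assoc)
qed

end

theory Submission
  imports Defs
begin

text \<open>Modulo scalars, the two double-braidings are rotations of the sphere by the angle \<open>4 \<pi> / (k + 2)\<close>
  about distinct axes. Neither is trivial or a half-turn, so no axis is invariant under the closed
  group \<open>K\<close> of unit quaternions that they generate. If \<open>K\<close> contains a nontrivial rotation by at most
  \<open>\<pi> / 3\<close>, then commutators of conjugates give arbitrarily small rotations, and by compactness \<open>K\<close>
  contains all rotations about some axis. The set of such axes is closed, invariant under \<open>K\<close>, and
  open because two of its points that are not parallel can be rotated about each other; hence it is
  the whole sphere. Some word in the double-braidings is a nontrivial rotation by at most \<open>\<pi> / 3\<close>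
  unless \<open>k = 4\<close> or \<open>k = 8\<close>, where the rotation groups are tetrahedral and icosahedral.\<close>

unbundle cross3_syntax

section \<open>Closed groups of unit quaternions\<close>

text \<open>The vector part of the conjugate \<open>(w, u) (0, v) (w, - u)\<close> for the
  quaternion product used below. For \<open>w = cos h\<close> and
  \<open>u = sin h *\<^sub>R e\<close> with a unit vector \<open>e\<close> it is a rotation about
  \<open>e\<close> by an angle of size \<open>2 h\<close>.\<close>

definition rot :: "real \<Rightarrow> real^3 \<Rightarrow> real^3 \<Rightarrow> real^3" where
  "rot w u v = (w\<^sup>2 - u \<bullet> u) *\<^sub>R v + (2 * (u \<bullet> v)) *\<^sub>R u - (2 * w) *\<^sub>R (u \<times> v)"

text \<open>Crossing with \<open>v\<close> and putting \<open>n = u \<times> v\<close> leaves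
  \<open>(u \<bullet> v) n = w (n \<times> v)\<close>. The two sides are orthogonal, so
  \<open>n \<times> v = 0\<close>; as \<open>n\<close> is also orthogonal to \<open>v\<close>, it
  vanishes. The condition on \<open>w\<close> excludes half-turns, which preserve every line
  perpendicular to \<open>u\<close>.\<close>

lemma rot_parallel_imp_parallel:
  assumes "rot w u v \<times> v = 0" "w \<noteq> 0"
  shows "u \<times> v = 0"
proof (cases "v = 0")
  case False
  define n where "n = u \<times> v"
  have eq: "(u \<bullet> v) *\<^sub>R n = w *\<^sub>R (n \<times> v)"
  proof -
    have "(2 * (u \<bullet> v)) *\<^sub>R n - (2 * w) *\<^sub>R (n \<times> v) = 0"
      using assms(1) by (simp add: rot_def n_def cross_add_left Cross3.left_diff_distrib cross_mult_left)
    then have "2 *\<^sub>R ((u \<bullet> v) *\<^sub>R n - w *\<^sub>R (n \<times> v)) = 0"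
      by (simp add: scaleR_right_diff_distrib)
    then show ?thesis by (simp only: scaleR_eq_0_iff) simp
  qed
  have "w * ((n \<times> v) \<bullet> (n \<times> v)) = (u \<bullet> v) * (n \<bullet> (n \<times> v))"
    using arg_cong[OF eq, of "\<lambda>x. x \<bullet> (n \<times> v)"] by simp
  then have "n \<times> v = 0" using assms(2) by (simp add: dot_cross_self)
  moreover have "n \<bullet> v = 0" by (simp add: n_def dot_cross_self)
  ultimately show ?thesis using cross_dot_cancel[of v n 0] False
    by (metis n_def cross_skew cross_zero_right inner_commute inner_zero_right neg_0_equal_iff_equal)
qed simp

text \<open>The vectors \<open>a\<close> and \<open>e \<times> a\<close> are an orthogonal frame,
  with equal lengths, of the plane perpendicular to \<open>e\<close>. The product
  \<open>x \<times> a\<close> is a multiple of \<open>e\<close>, and expanding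
  \<open>a \<times> (x \<times> a)\<close> in two ways gives the coordinates.\<close>

lemma orthogonal_frame_decomposition:
  fixes a e x :: "real^3"
  assumes "e \<bullet> e = 1" "a \<bullet> e = 0" "x \<bullet> e = 0"
  shows "(a \<bullet> a) *\<^sub>R x = (x \<bullet> a) *\<^sub>R a + (x \<bullet> (e \<times> a)) *\<^sub>R (e \<times> a)"
proof -
  have 1: "e \<times> (x \<times> a) = 0"
    using assms by (simp add: Lagrange inner_commute)
  have "e \<times> (e \<times> (x \<times> a)) = (e \<bullet> (x \<times> a)) *\<^sub>R e - x \<times> a"
    using assms Lagrange[of e e "x \<times> a"] by simp
  then have "x \<times> a = (e \<bullet> (x \<times> a)) *\<^sub>R e" using 1 by simp
  then have "a \<times> (x \<times> a) = (e \<bullet> (x \<times> a)) *\<^sub>R (a \<times> e)"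
    by (metis cross_mult_right)
  moreover have "e \<bullet> (x \<times> a) = - (x \<bullet> (e \<times> a))"
    by (metis cross_skew cross_triple inner_commute inner_minus_left)
  moreover have "a \<times> (x \<times> a) = (a \<bullet> a) *\<^sub>R x - (x \<bullet> a) *\<^sub>R a"
    by (simp add: Lagrange inner_commute)
  moreover have "a \<times> e = - (e \<times> a)" by (rule cross_skew)
  ultimately show ?thesis by (simp add: algebra_simps)
qed

text \<open>The pair \<open>(w, v)\<close> stands for the unit quaternion \<open>w - v\<close>, hence the sign of the cross product.\<close>

locale unit_quaternion_group =
  fixes K :: "(real \<times> (real^3)) set"
  assumes closed: "closed K"
    and unit: "(w, v) \<in> K \<Longrightarrow> w\<^sup>2 + v \<bullet> v = 1"
    and minus_one: "(-1, 0) \<in> K"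
    and inv: "(w, v) \<in> K \<Longrightarrow> (w, - v) \<in> K"
    and mult: "(w, v) \<in> K \<Longrightarrow> (w', v') \<in> K \<Longrightarrow> (w * w' - v \<bullet> v', w *\<^sub>R v' + w' *\<^sub>R v - v \<times> v') \<in> K"
begin

lemma one: "(1, 0) \<in> K"
  using mult[OF minus_one minus_one] by simp

lemma neg: "(w, v) \<in> K \<Longrightarrow> (- w, - v) \<in> K"
  using mult[OF minus_one, of w v] by simp

lemma square: "(w, v) \<in> K \<Longrightarrow> (2 * w\<^sup>2 - 1, (2 * w) *\<^sub>R v) \<in> K"
proof -
  assume *: "(w, v) \<in> K"
  have "w * w - v \<bullet> v = 2 * w\<^sup>2 - 1" using unit[OF *] by (simp add: power2_eq_square)
  moreover have "w *\<^sub>R v + w *\<^sub>R v - v \<times> v = (2 * w) *\<^sub>R v" by (simp flip: scaleR_add_left)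
  ultimately show ?thesis using mult[OF * *] by simp
qed

text \<open>The scalar part is the cosine of half the rotation angle, so this is the triple-angle
  formula.\<close>

lemma cube:
  assumes "(w, v) \<in> K"
  shows "(4 * w ^ 3 - 3 * w, (4 * w\<^sup>2 - 1) *\<^sub>R v) \<in> K"
proof -
  have vv: "v \<bullet> v = 1 - w\<^sup>2" using unit[OF assms] by simp
  have "w * (2 * w\<^sup>2 - 1) - v \<bullet> ((2 * w) *\<^sub>R v) = 4 * w ^ 3 - 3 * w"
    by (simp add: vv power3_eq_cube power2_eq_square) (simp add: algebra_simps)
  moreover have "w *\<^sub>R ((2 * w) *\<^sub>R v) + (2 * w\<^sup>2 - 1) *\<^sub>R v - v \<times> ((2 * w) *\<^sub>R v) = (4 * w\<^sup>2 - 1) *\<^sub>R v"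
    by (simp add: cross_mult_right power2_eq_square flip: scaleR_add_left)
  ultimately show ?thesis using mult[OF assms square[OF assms]] by simp
qed

lemma power:
  assumes "(cos \<theta>, sin \<theta> *\<^sub>R e) \<in> K" "norm e = 1"
  shows "(cos (real m * \<theta>), sin (real m * \<theta>) *\<^sub>R e) \<in> K"
proof (induction m)
  case 0
  then show ?case using one by simp
next
  case (Suc m)
  have "e \<bullet> e = 1" using assms(2) by (simp add: dot_square_norm)
  moreover have "real (Suc m) * \<theta> = real m * \<theta> + \<theta>" by (simp add: algebra_simps)
  ultimately show ?case using mult[OF Suc.IH assms(1)]
    by (simp add: cos_add sin_add cross_mult_left cross_mult_right add.commute mult.commute
        del: of_nat_Suc flip: scaleR_add_left)
qed

lemma conjugate:
  assumes "(w, u) \<in> K" "(w', v) \<in> K"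
  shows "(w', rot w u v) \<in> K"
proof -
  define n where "n = u \<times> v"
  have *: "n \<times> u = (u \<bullet> u) *\<^sub>R v - (u \<bullet> v) *\<^sub>R u"
    unfolding n_def by (subst cross_skew) (simp add: Lagrange inner_commute)
  have nu: "n \<bullet> u = 0" "u \<bullet> n = 0" by (simp_all add: n_def dot_cross_self)
  have vu: "v \<times> u = - n" unfolding n_def by (rule cross_skew)
  have "(w * w' - u \<bullet> v) * w - (w *\<^sub>R v + w' *\<^sub>R u - n) \<bullet> (- u) = w' * (w\<^sup>2 + u \<bullet> u)"
    by (simp add: inner_diff_left inner_add_left nu algebra_simps power2_eq_square inner_commute[of v u])
  then have "(w * w' - u \<bullet> v) * w - (w *\<^sub>R v + w' *\<^sub>R u - n) \<bullet> (- u) = w'"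
    using unit[OF assms(1)] by simp
  moreover have "(w * w' - u \<bullet> v) *\<^sub>R (- u) + w *\<^sub>R (w *\<^sub>R v + w' *\<^sub>R u - n) -
      (w *\<^sub>R v + w' *\<^sub>R u - n) \<times> (- u) = rot w u v"
    by (simp add: rot_def cross_add_left Cross3.left_diff_distrib cross_mult_left vu * algebra_simps
        vec_eq_iff power2_eq_square n_def[symmetric])
  ultimately show ?thesis
    using mult[OF mult[OF assms] inv[OF assms(1)]] by (simp add: n_def)
qed

text \<open>Writing A and B for the two elements, A B and the product of their inverses have the
  same scalar part and vector parts \<open>s - n\<close> and \<open>- s - n\<close> with
  \<open>s\<close> orthogonal to \<open>n = a \<times> b\<close>. In their product only the sign of
  \<open>n \<bullet> n\<close> differs from the sum giving the norm, which is 1.\<close>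

lemma commutator:
  assumes "(w, a) \<in> K" "(w, b) \<in> K"
  shows "\<exists>v. (1 - 2 * ((a \<times> b) \<bullet> (a \<times> b)), v) \<in> K"
proof -
  define n where "n = a \<times> b"
  define s where "s = w *\<^sub>R (a + b)"
  have 1: "(w * w - a \<bullet> b, s - n) \<in> K"
    using mult[OF assms] by (simp add: n_def s_def algebra_simps)
  have 2: "(w * w - a \<bullet> b, - s - n) \<in> K"
    using mult[OF inv inv, OF assms] by (simp add: n_def s_def algebra_simps)
  have sn: "s \<bullet> n = 0"
    by (simp add: s_def n_def inner_add_left dot_cross_self)
  have "(w * w - a \<bullet> b)\<^sup>2 + (s - n) \<bullet> (s - n) = 1"
    using unit[OF 1] by simp
  then have "(w * w - a \<bullet> b) * (w * w - a \<bullet> b) - (s - n) \<bullet> (- s - n) = 1 - 2 * (n \<bullet> n)"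
    using sn by (simp add: inner_diff_left inner_diff_right power2_eq_square inner_commute)
  then show ?thesis using mult[OF 1 2] n_def by auto
qed

lemma compact: "compact K"
proof -
  have "norm x \<le> 1" if "x \<in> K" for x
    using unit[of "fst x" "snd x"] that by (cases x) (simp add: norm_Pair power2_norm_eq_inner)
  then show ?thesis using closed bounded_iff compact_eq_bounded_closed by blast
qed

end

section \<open>Groups without an invariant axis, and their elements of small angle\<close>

locale irreducible_quaternion_group = unit_quaternion_group +
  assumes irreducible: "v \<noteq> 0 \<Longrightarrow> \<exists>(w, u) \<in> K. rot w u v \<times> v \<noteq> 0"
begin

text \<open>An element of smallest angle commutes with its conjugates, because a commutator of two rotations
  by the same small angle has an even smaller angle; so its axis would be invariant.\<close>

lemma arbitrarily_small:
  assumes "(w0, v0) \<in> K" "v0 \<noteq> 0" "v0 \<bullet> v0 \<le> 1/4" "\<epsilon> > 0"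
  shows "\<exists>(w, v) \<in> K. v \<noteq> 0 \<and> norm v < \<epsilon>"
proof (rule ccontr)
  assume "\<not> ?thesis"
  then have big: "v = 0 \<or> norm v \<ge> \<epsilon>" if "(w, v) \<in> K" for w v using that by fastforce
  \<comment> \<open>The assumed gap replaces the open condition \<open>v \<noteq> 0\<close> by a
    closed one, so the minimum of \<open>v \<bullet> v\<close> over nontrivial elements is
    attained.\<close>
  define C where "C = K \<inter> (snd -` {v. norm v \<ge> \<epsilon>})"
  have "closed {v :: real^3. norm v \<ge> \<epsilon>}" by (intro closed_Collect_le continuous_intros)
  then have "closed (snd -` {v :: real^3. norm v \<ge> \<epsilon>} :: (real \<times> (real^3)) set)"
    by (rule closed_vimage) (intro continuous_intros)
  then have "compact C" unfolding C_def using compact by (rule compact_Int_closed[rotated])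
  moreover have "(w0, v0) \<in> C" using assms big C_def by fastforce
  moreover have "continuous_on C (\<lambda>x. snd x \<bullet> snd x)" by (intro continuous_intros)
  ultimately obtain x where x: "x \<in> C" and xmin: "\<And>y. y \<in> C \<Longrightarrow> snd x \<bullet> snd x \<le> snd y \<bullet> snd y"
    using continuous_attains_inf[of C "\<lambda>x. snd x \<bullet> snd x"] by blast
  obtain w v where wv: "x = (w, v)" by (cases x)
  have K: "(w, v) \<in> K" using x wv C_def by auto
  have v0: "v \<noteq> 0" using x wv C_def assms(4) by auto
  have vmin: "v \<bullet> v \<le> v' \<bullet> v'" if "(w', v') \<in> K" "v' \<noteq> 0" for w' v'
    using xmin[of "(w', v')"] big that wv C_def by fastforce
  have v4: "v \<bullet> v \<le> 1/4" using vmin[OF assms(1,2)] assms(3) by linarith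
  have vpos: "v \<bullet> v > 0" using v0 by simp
  have "rot w' u v \<times> v = 0" if "(w', u) \<in> K" for w' u
  proof -
    define b where "b = rot w' u v"
    have b: "(w, b) \<in> K" using conjugate[OF that K] b_def by simp
    have bb: "b \<bullet> b = v \<bullet> v" using unit[OF b] unit[OF K] by simp
    define p where "p = (b \<times> v) \<bullet> (b \<times> v)"
    obtain c where c: "(1 - 2 * p, c) \<in> K"
      using commutator[OF b K] p_def by auto
    have cc: "c \<bullet> c = 4 * p * (1 - p)"
      using unit[OF c] by (simp add: power2_eq_square algebra_simps)
    have p0: "p \<ge> 0" by (simp add: p_def)
    have "p = (b \<bullet> b) * (v \<bullet> v) - (b \<bullet> v)\<^sup>2"
      by (simp add: p_def dot_cross power2_eq_square inner_commute)
    \<comment> \<open>Here the bound 1/4 enters: it makes \<open>4 * p\<close>, which exceeds the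
      squared vector part of the commutator if \<open>p\<close> is nonzero, at most the minimum
      \<open>v \<bullet> v\<close>.\<close>
    then have "p \<le> (v \<bullet> v) * (v \<bullet> v)" using bb by simp
    also have "\<dots> \<le> 1/4 * (v \<bullet> v)" using v4 vpos by (intro mult_right_mono) auto
    finally have p: "4 * p \<le> v \<bullet> v" by simp
    show ?thesis
    proof (cases "p = 0")
      case True
      then show ?thesis by (simp add: p_def b_def)
    next
      case False
      then have "4 * p * (1 - p) < 4 * p * 1" using p0 by (intro mult_strict_left_mono) auto
      then have "c \<bullet> c < v \<bullet> v" using cc p by simp
      \<comment> \<open>Minimality makes the commutator plus or minus the identity. This leaves
        \<open>p = 1\<close>, which contradicts \<open>4 * p \<le> v \<bullet> v\<close>.\<close>
      then have "c = 0" using vmin[OF c] by force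
      then have "4 * p * (1 - p) = 0" using cc by simp
      then have "p = 1" using False by simp
      then show ?thesis using p v4 by simp
    qed
  qed
  then show False using irreducible[OF v0] by blast
qed

section \<open>Axes about which all rotations lie in the group\<close>

definition axes :: "(real^3) set" where
  "axes = {e. norm e = 1 \<and> (\<forall>t. (cos t, sin t *\<^sub>R e) \<in> K)}"

text \<open>Elements of half-angle \<open>\<theta> n\<close> tending to 0 have unit axes with a
  convergent subsequence. Suitable multiples of \<open>\<theta> n\<close> tend to any prescribed
  \<open>t\<close>, so closedness puts the whole circle about the limit axis in
  \<open>K\<close>.\<close>

lemma axes_nonempty:
  assumes "(w0, v0) \<in> K" "v0 \<noteq> 0" "v0 \<bullet> v0 \<le> 1/4"
  shows "axes \<noteq> {}"
proof -
  have "\<exists>v. (sqrt (1 - v \<bullet> v), v) \<in> K \<and> v \<noteq> 0 \<and> norm v < inverse (real (Suc n))" for n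
  proof -
    obtain w v where v: "(w, v) \<in> K" "v \<noteq> 0" "norm v < inverse (real (Suc n))"
      using arbitrarily_small[OF assms, of "inverse (real (Suc n))"] by auto
    have "w\<^sup>2 = 1 - v \<bullet> v" using unit[OF v(1)] by simp
    \<comment> \<open>Negating the quaternion does not change the rotation. With the nonnegative
      root as scalar part, the half-angle is \<open>arcsin (norm v)\<close> and hence small.\<close>
    then have "w = sqrt (1 - v \<bullet> v) \<or> - w = sqrt (1 - v \<bullet> v)"
      by (metis abs_if real_sqrt_abs)
    then show ?thesis
    proof
      assume "w = sqrt (1 - v \<bullet> v)"
      then show ?thesis using v by blast
    next
      assume "- w = sqrt (1 - v \<bullet> v)"
      then show ?thesis using v neg[OF v(1)] by (intro exI[of _ "- v"]) simp
    qed
  qed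
  then have "\<exists>v. \<forall>n. (sqrt (1 - v n \<bullet> v n), v n) \<in> K \<and> v n \<noteq> 0 \<and> norm (v n) < inverse (real (Suc n))"
    by (intro choice allI)
  then obtain v where v: "\<And>n. (sqrt (1 - v n \<bullet> v n), v n) \<in> K" "\<And>n. v n \<noteq> 0"
      "\<And>n. norm (v n) < inverse (real (Suc n))" by blast
  have lim: "(\<lambda>n. norm (v n)) \<longlonglongrightarrow> 0"
    by (rule tendsto_sandwich[OF _ _ tendsto_const LIMSEQ_inverse_real_of_nat])
      (auto intro!: always_eventually less_imp_le v(3) simp del: of_nat_Suc)
  define E where "E n = v n /\<^sub>R norm (v n)" for n
  have E: "norm (E n) = 1" for n using v(2) by (simp add: E_def)
  have "seq_compact (sphere (0 :: real^3) 1)"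
    using compact_sphere compact_eq_seq_compact_metric by blast
  then obtain e r where e: "e \<in> sphere 0 1" and r: "strict_mono r" and Er: "(E \<circ> r) \<longlonglongrightarrow> e"
    using E unfolding seq_compact_def by (metis (no_types, lifting) mem_sphere_0)
  define \<theta> where "\<theta> n = arcsin (norm (v (r n)))" for n
  have v1: "norm (v n) \<le> 1" for n
  proof -
    have "inverse (real (Suc n)) \<le> 1" by (simp add: field_simps)
    then show ?thesis using v(3)[of n] by linarith
  qed
  have vp: "norm (v n) > 0" for n using v(2) by simp
  have \<theta>pos: "\<theta> n > 0" for n
    unfolding \<theta>_def using arcsin_less_arcsin[of 0 "norm (v (r n))"] v1 vp by simp
  have "(\<lambda>n. norm (v (r n))) \<longlonglongrightarrow> 0"
    using LIMSEQ_subseq_LIMSEQ[OF lim r] by (simp add: o_def)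
  then have \<theta>lim: "\<theta> \<longlonglongrightarrow> 0"
    unfolding \<theta>_def using isCont_tendsto_compose[OF isCont_arcsin[of 0]] by fastforce
  have K\<theta>: "(cos (\<theta> n), sin (\<theta> n) *\<^sub>R E (r n)) \<in> K" for n
  proof -
    have "cos (\<theta> n) = sqrt (1 - v (r n) \<bullet> v (r n))"
      using v1[of "r n"] unfolding \<theta>_def
      by (subst cos_arcsin) (auto simp: power2_norm_eq_inner intro: order_trans[of _ 0])
    moreover have "sin (\<theta> n) *\<^sub>R E (r n) = v (r n)"
    proof -
      have "sin (\<theta> n) = norm (v (r n))"
        using v1[of "r n"] unfolding \<theta>_def by (subst sin_arcsin) (auto intro: order_trans[of _ 0])
      then show ?thesis using v(2) by (simp add: E_def)
    qed
    ultimately show ?thesis using v(1) by simp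
  qed
  have pos: "(cos t, sin t *\<^sub>R e) \<in> K" if "t \<ge> 0" for t
  proof -
    \<comment> \<open>Rounding \<open>t / \<theta> n\<close> down leaves an error of at most one
      step \<open>\<theta> n\<close>, which tends to 0.\<close>
    define m where "m n = nat \<lfloor>t / \<theta> n\<rfloor>" for n
    have "\<bar>real (m n) * \<theta> n - t\<bar> \<le> \<theta> n" for n
    proof -
      have "real (m n) = of_int \<lfloor>t / \<theta> n\<rfloor>"
        using that \<theta>pos[of n] by (simp add: m_def)
      then have "real (m n) \<le> t / \<theta> n" "t / \<theta> n \<le> real (m n) + 1" by linarith+
      then show ?thesis using \<theta>pos[of n] by (simp add: field_simps abs_le_iff)
    qed
    then have "(\<lambda>n. real (m n) * \<theta> n - t) \<longlonglongrightarrow> 0"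
      by (intro tendsto_rabs_zero_cancel[OF tendsto_sandwich[OF _ _ tendsto_const \<theta>lim]]) auto
    then have mt: "(\<lambda>n. real (m n) * \<theta> n) \<longlonglongrightarrow> t"
      using Lim_null by blast
    have "(\<lambda>n. (cos (real (m n) * \<theta> n), sin (real (m n) * \<theta> n) *\<^sub>R E (r n))) \<longlonglongrightarrow> (cos t, sin t *\<^sub>R e)"
      using Er mt by (intro tendsto_intros) (simp_all add: o_def)
    then show ?thesis
      by (rule closed_sequentially[OF closed, rotated]) (rule power[OF K\<theta> E])
  qed
  have "(cos t, sin t *\<^sub>R e) \<in> K" for t
  proof (cases "t \<ge> 0")
    case False
    then show ?thesis using inv[OF pos[of "- t"]] by simp
  qed (use pos in auto)
  then show ?thesis using e by (auto simp: axes_def)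
qed

lemma axes_rot:
  assumes "e \<in> axes" "(w, u) \<in> K"
  shows "rot w u e \<in> axes"
proof -
  have *: "rot w u (c *\<^sub>R e) = c *\<^sub>R rot w u e" for c
    by (simp add: rot_def cross_mult_right algebra_simps)
  have K: "(cos t, sin t *\<^sub>R rot w u e) \<in> K" for t
    using conjugate[OF assms(2), of "cos t" "sin t *\<^sub>R e"] assms(1) by (simp add: axes_def *)
  moreover have "norm (rot w u e) = 1"
    \<comment> \<open>At \<open>pi/2\<close> the scalar part vanishes, so the vector part itself has
      norm 1.\<close>
    using unit[OF K[of "pi/2"]] by (simp add: norm_eq_1)
  ultimately show ?thesis by (simp add: axes_def)
qed

text \<open>Equal inner products with \<open>e\<close> put \<open>f\<close> and \<open>g\<close> on
  one circle of latitude about \<open>e\<close>. A rotation about \<open>e\<close> takes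
  \<open>f\<close> to \<open>g\<close>; it lies in \<open>K\<close>, and \<open>axes\<close> is
  invariant under \<open>K\<close>.\<close>

lemma axes_transport:
  assumes e: "e \<in> axes" and f: "f \<in> axes" and ef: "e \<times> f \<noteq> 0"
    and g: "norm g = 1" "g \<bullet> e = f \<bullet> e"
  shows "g \<in> axes"
proof -
  define c where "c = f \<bullet> e"
  define a where "a = f - c *\<^sub>R e"
  define x where "x = g - c *\<^sub>R e"
  have ee: "e \<bullet> e = 1" and ff: "f \<bullet> f = 1" and gg: "g \<bullet> g = 1"
    using e f g by (simp_all add: axes_def norm_eq_1)
  have ae: "a \<bullet> e = 0" and xe: "x \<bullet> e = 0"
    using ee g by (simp_all add: a_def x_def c_def inner_diff_left)
  have aa: "a \<bullet> a = 1 - c\<^sup>2"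
    using ee ff by (simp add: a_def inner_diff_left inner_diff_right inner_commute c_def power2_eq_square)
  have xx: "x \<bullet> x = 1 - c\<^sup>2"
    using ee gg g(2) by (simp add: x_def inner_diff_left inner_diff_right inner_commute c_def power2_eq_square)
  have ea: "e \<times> a = e \<times> f"
    by (simp add: a_def Cross3.right_diff_distrib cross_mult_right)
  then have "a \<noteq> 0" using ef by auto
  then have s: "a \<bullet> a \<noteq> 0" by simp
  define \<alpha> where "\<alpha> = (x \<bullet> a) / (a \<bullet> a)"
  define \<beta> where "\<beta> = (x \<bullet> (e \<times> a)) / (a \<bullet> a)"
  have "x = (1 / (a \<bullet> a)) *\<^sub>R ((a \<bullet> a) *\<^sub>R x)" using s by simp
  also have "\<dots> = \<alpha> *\<^sub>R a + \<beta> *\<^sub>R (e \<times> a)"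
    unfolding orthogonal_frame_decomposition[OF ee ae xe]
    by (simp add: \<alpha>_def \<beta>_def scaleR_add_right)
  finally have x: "x = \<alpha> *\<^sub>R a + \<beta> *\<^sub>R (e \<times> a)" .
  have "x \<bullet> x = \<alpha> * (x \<bullet> a) + \<beta> * (x \<bullet> (e \<times> a))"
    by (subst (2) x) (simp add: inner_add_right)
  also have "\<dots> = (a \<bullet> a) * (\<alpha>\<^sup>2 + \<beta>\<^sup>2)"
    using s by (simp add: \<alpha>_def \<beta>_def power2_eq_square field_simps)
  finally have "\<alpha>\<^sup>2 + \<beta>\<^sup>2 = 1" using s aa xx by simp
  then obtain t where t: "\<alpha> = cos t" "- \<beta> = sin t"
    using sincos_total_2pi[of \<alpha> "- \<beta>"] by auto
  \<comment> \<open>Conjugation doubles the angle, so the quaternion uses half of \<open>t\<close>;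
    the minus sign at \<open>\<beta>\<close> comes from the sign of the cross product in
    \<open>rot\<close>.\<close>
  define h where "h = t / 2"
  have h: "\<alpha> = (cos h)\<^sup>2 - (sin h)\<^sup>2" "\<beta> = - (2 * sin h * cos h)" "(cos h)\<^sup>2 = 1 - (sin h)\<^sup>2"
    using t cos_double[of h] sin_double[of h] by (simp_all add: h_def cos_squared_eq)
  have "rot (cos h) (sin h *\<^sub>R e) f = \<alpha> *\<^sub>R f + (2 * (sin h)\<^sup>2 * c) *\<^sub>R e + \<beta> *\<^sub>R (e \<times> f)"
    using ee by (simp add: rot_def h(1,2) cross_mult_left c_def inner_commute power2_eq_square algebra_simps)
  also have "\<dots> = g"
  proof -
    have "g = \<alpha> *\<^sub>R a + \<beta> *\<^sub>R (e \<times> f) + c *\<^sub>R e" using x x_def ea by (simp add: algebra_simps)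
    also have "\<dots> = \<alpha> *\<^sub>R f + (c * (1 - \<alpha>)) *\<^sub>R e + \<beta> *\<^sub>R (e \<times> f)" by (simp add: a_def algebra_simps)
    also have "c * (1 - \<alpha>) = 2 * (sin h)\<^sup>2 * c" by (simp add: h(1,3))
    finally show ?thesis by simp
  qed
  finally have "g = rot (cos h) (sin h *\<^sub>R e) f" ..
  then show ?thesis using axes_rot[OF f] e by (auto simp: axes_def)
qed

text \<open>Rotating \<open>x\<close> about \<open>y\<close> sweeps out axes \<open>x'\<close> whose
  inner products with \<open>x\<close> fill the interval from \<open>2 * c\<^sup>2 - 1\<close>, at
  the opposite point of the circle, to 1. Any \<open>g\<close> in the cap shares its latitude about
  \<open>x\<close> with such an \<open>x'\<close>, and a rotation about \<open>x\<close> takes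
  \<open>x'\<close> to \<open>g\<close>.\<close>

lemma axes_contain_cap:
  assumes x: "x \<in> axes" and y: "y \<in> axes" and xy: "y \<times> x \<noteq> 0"
  shows "\<exists>d<1. \<forall>g. norm g = 1 \<longrightarrow> g \<bullet> x > d \<longrightarrow> g \<in> axes"
proof -
  define c where "c = x \<bullet> y"
  define a where "a = x - c *\<^sub>R y"
  define n where "n = y \<times> x"
  have xx: "x \<bullet> x = 1" and yy: "y \<bullet> y = 1" using x y by (simp_all add: axes_def norm_eq_1)
  have nn: "n \<bullet> n = 1 - c\<^sup>2"
    by (simp add: n_def dot_cross xx yy c_def power2_eq_square inner_commute)
  have s: "1 - c\<^sup>2 > 0" using xy nn n_def by (metis inner_gt_zero_iff)
  have an: "a \<bullet> n = 0" "n \<bullet> a = 0" and ny: "n \<bullet> y = 0" "y \<bullet> n = 0" "n \<bullet> x = 0"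
    by (simp_all add: a_def n_def inner_diff_left inner_diff_right dot_cross_self)
  have ay: "a \<bullet> y = 0" "y \<bullet> a = 0"
    by (simp_all add: a_def inner_diff_left inner_diff_right yy c_def inner_commute)
  have ax: "a \<bullet> x = 1 - c\<^sup>2"
    by (simp add: a_def inner_diff_left xx c_def inner_commute[of y x] power2_eq_square)
  have aa: "a \<bullet> a = 1 - c\<^sup>2"
    using ax ay by (simp add: a_def inner_diff_right)
  have "g \<in> axes" if g: "norm g = 1" "g \<bullet> x > 2 * c\<^sup>2 - 1" for g
  \<comment> \<open>If \<open>g\<close> is parallel to \<open>x\<close>, it is \<open>x\<close> or
    \<open>- x\<close>, and the inverses in \<open>K\<close> make \<open>axes\<close>
    symmetric.\<close>
  proof (cases "g \<times> x = 0")
    case True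
    define d where "d = g \<bullet> x"
    have gg: "g \<bullet> g = 1" using g by (simp add: norm_eq_1)
    have "x \<times> (g \<times> x) = g - (x \<bullet> g) *\<^sub>R x" by (simp add: Lagrange xx)
    then have gd: "g = d *\<^sub>R x" using True by (simp add: d_def inner_commute)
    then have "d * d = 1" using gg xx by simp
    then consider "d = 1" | "d = -1" using square_eq_1_iff by blast
    then show ?thesis
    proof cases
      case 1
      then show ?thesis using gd x by simp
    next
      case 2
      have "(cos t, sin t *\<^sub>R (- x)) \<in> K" for t
        using x inv[of "cos t" "sin t *\<^sub>R x"] by (simp add: axes_def)
      then show ?thesis using gd 2 x by (simp add: axes_def)
    qed
  next
    case False
    define d where "d = g \<bullet> x"
    have d1: "d \<le> 1" using norm_cauchy_schwarz[of g x] g x by (simp add: d_def axes_def)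
    \<comment> \<open>In the frame \<open>a\<close>, \<open>n\<close> of the circle about
      \<open>y\<close>, \<open>p\<close> is the coordinate that gives
      \<open>x' \<bullet> x = g \<bullet> x\<close>, and \<open>r\<close> completes it to a point of
      the circle.\<close>
    define p where "p = (d - c\<^sup>2) / (1 - c\<^sup>2)"
    define r where "r = sqrt (1 - p\<^sup>2)"
    have "\<bar>p\<bar> \<le> 1" using s d1 g(2) by (simp add: p_def d_def abs_le_iff field_simps)
    then have r: "p\<^sup>2 + r\<^sup>2 = 1" by (simp add: r_def abs_square_le_1)
    define x' where "x' = c *\<^sub>R y + p *\<^sub>R a + r *\<^sub>R n"
    have "x' \<bullet> x' = c\<^sup>2 + (p\<^sup>2 + r\<^sup>2) * (1 - c\<^sup>2)"
      by (simp add: x'_def inner_add_left inner_add_right an ny ay aa nn yy power2_eq_square algebra_simps)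
    then have 1: "norm x' = 1" using r by (simp add: norm_eq_1)
    have 2: "x' \<bullet> y = x \<bullet> y"
      by (simp add: x'_def inner_add_left an ny ay yy c_def)
    have "x' \<bullet> x = c\<^sup>2 + p * (1 - c\<^sup>2)"
      by (simp add: x'_def inner_add_left ny ax c_def inner_commute[of y x] power2_eq_square)
    then have 3: "x' \<bullet> x = g \<bullet> x" using s by (simp add: p_def d_def)
    have x': "x' \<in> axes" using axes_transport[OF y x xy 1 2] .
    have "x \<times> x' \<noteq> 0"
    proof
      assume "x \<times> x' = 0"
      then have "(x \<bullet> x') * (x \<bullet> x') = 1"
        using dot_cross[of x x' x x'] xx 1 by (simp add: norm_eq_1 inner_commute)
      then have "(g \<bullet> x)\<^sup>2 = 1" using 3 by (simp add: power2_eq_square inner_commute)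
      then have "(g \<times> x) \<bullet> (g \<times> x) = 0"
        using g xx by (simp add: dot_cross norm_eq_1 power2_eq_square inner_commute)
      then show False using False by simp
    qed
    then show ?thesis using axes_transport[OF x x' _ g(1)] 3 by simp
  qed
  moreover have "2 * c\<^sup>2 - 1 < 1" using s by simp
  ultimately show ?thesis by blast
qed

text \<open>The set is closed because \<open>K\<close> is. It is open because irreducibility moves
  each axis to another one not parallel to it, and the two give a cap. The sphere is
  connected.\<close>

lemma axes_eq_sphere:
  assumes "axes \<noteq> {}"
  shows "axes = sphere 0 1"
proof -
  have sub: "axes \<subseteq> sphere 0 1" by (auto simp: axes_def)
  have "closed {e. (cos t, sin t *\<^sub>R e) \<in> K}" for t
    using continuous_closed_vimage[OF closed, of "\<lambda>e. (cos t, sin t *\<^sub>R e)"]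
    by (simp add: vimage_def continuous_intros)
  then have "closed (sphere 0 1 \<inter> (\<Inter>t. {e. (cos t, sin t *\<^sub>R e) \<in> K}))"
    by (intro closed_Int closed_INT) auto
  moreover have "axes = sphere 0 1 \<inter> (\<Inter>t. {e. (cos t, sin t *\<^sub>R e) \<in> K})"
    by (auto simp: axes_def)
  ultimately have cl: "closedin (top_of_set (sphere 0 1)) axes"
    using sub by (metis closed_subset)
  have "\<exists>\<epsilon>>0. \<forall>g \<in> sphere 0 1. dist g x < \<epsilon> \<longrightarrow> g \<in> axes" if x: "x \<in> axes" for x
  proof -
    have "x \<noteq> 0" using x by (auto simp: axes_def)
    then obtain w u where "(w, u) \<in> K" "rot w u x \<times> x \<noteq> 0" using irreducible by blast
    then obtain d where d: "d < 1" "\<And>g. norm g = 1 \<Longrightarrow> g \<bullet> x > d \<Longrightarrow> g \<in> axes"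
      using axes_contain_cap[OF x axes_rot[OF x]] by blast
    \<comment> \<open>On the unit sphere the squared distance is
      \<open>2 - 2 * (g \<bullet> x)\<close>, which turns the cap into a metric ball.\<close>
    have "g \<in> axes" if "g \<in> sphere 0 1" "dist g x < sqrt (2 * (1 - d))" for g
    proof (rule d(2))
      show "norm g = 1" using that by simp
      have "(dist g x)\<^sup>2 < 2 * (1 - d)"
        using power_strict_mono[OF that(2), of 2] d(1) by simp
      moreover have "(dist g x)\<^sup>2 = 2 - 2 * (g \<bullet> x)"
        using that x unfolding dist_norm power2_norm_eq_inner
        by (simp add: inner_diff_left inner_diff_right inner_commute axes_def norm_eq_1)
      ultimately show "g \<bullet> x > d" by simp
    qed
    then show ?thesis using d(1) by (intro exI[of _ "sqrt (2 * (1 - d))"]) auto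
  qed
  then have "openin (top_of_set (sphere 0 1)) axes"
    unfolding openin_euclidean_subtopology_iff using sub by blast
  moreover have "connected (sphere (0 :: real^3) 1)"
    by (rule connected_sphere) simp
  ultimately show ?thesis using cl assms connected_clopen by blast
qed

theorem contains_unit_quaternions:
  assumes "(w0, v0) \<in> K" "v0 \<noteq> 0" "v0 \<bullet> v0 \<le> 1/4"
    and "w\<^sup>2 + u \<bullet> u = 1"
  shows "(w, u) \<in> K"
proof (cases "u = 0")
  case True
  then have "w = 1 \<or> w = -1" using assms(4) power2_eq_1_iff by auto
  then show ?thesis using one minus_one True by auto
next
  case False
  obtain t where t: "w = cos t" "norm u = sin t"
    using sincos_total_2pi[of w "norm u"] assms(4) by (auto simp: power2_norm_eq_inner)
  have "u /\<^sub>R norm u \<in> axes"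
    using axes_eq_sphere[OF axes_nonempty[OF assms(1-3)]] False by simp
  then have "(cos t, sin t *\<^sub>R (u /\<^sub>R norm u)) \<in> K" by (simp add: axes_def)
  then show ?thesis using t(2)[symmetric] t(1) False by simp
qed

end


section \<open>Quaternions and unitary matrices\<close>

text \<open>The matrix of w + i (v1 X + v2 Y + v3 Z) with the Pauli matrices X, Y, Z. The factor i
  is what gives the cross product its minus sign.\<close>

definition su :: "real \<Rightarrow> real^3 \<Rightarrow> complex^2^2" where
  "su w v = vector [vector [Complex w (v$3), Complex (v$2) (v$1)],
                    vector [Complex (- v$2) (v$1), Complex w (- v$3)]]"

lemma su_mult: "su w v ** su w' v' = su (w * w' - v \<bullet> v') (w *\<^sub>R v' + w' *\<^sub>R v - v \<times> v')"
  by (simp add: su_def vec_eq_iff forall_2 matrix_matrix_mult_def sum_2 complex_eq_iff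
      inner_vec_def sum_3 cross_components algebra_simps)

lemma conj_transpose_su: "conj_transpose (su w v) = su w (- v)"
  by (simp add: su_def conj_transpose_def vec_eq_iff forall_2 complex_eq_iff)

lemma scalar_su: "mat (of_real x) ** su w v = su (x * w) (x *\<^sub>R v)"
  by (simp add: su_def vec_eq_iff forall_2 matrix_matrix_mult_def sum_2 mat_def complex_eq_iff)

text \<open>The square of \<open>su 0 f\<close> is minus the identity, so this product is minus a
  conjugation by the half-turn about \<open>f\<close>. It describes the effect of the matrix
  F.\<close>

lemma reflection_su:
  assumes "f \<bullet> f = 1"
  shows "su 0 f ** su w v ** su 0 f = su (- w) (- rot 0 f v)"
proof -
  have "(f \<times> v) \<times> f = v - (f \<bullet> v) *\<^sub>R f"
    using assms by (subst cross_skew) (simp add: Lagrange)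
  then have "- (f \<bullet> v) *\<^sub>R f - (w *\<^sub>R f - f \<times> v) \<times> f = - rot 0 f v"
    by (simp add: rot_def assms Cross3.left_diff_distrib cross_mult_left vec_eq_iff algebra_simps)
  then show ?thesis
    by (simp add: su_mult assms inner_diff_left dot_cross_self)
qed

lemma tendsto_su:
  assumes "(f \<longlongrightarrow> w) F" "(g \<longlongrightarrow> v) F"
  shows "((\<lambda>x. su (f x) (g x)) \<longlongrightarrow> su w v) F"
proof (intro vec_tendstoI)
  fix i j :: 2
  show "((\<lambda>x. su (f x) (g x) $ i $ j) \<longlongrightarrow> su w v $ i $ j) F"
    using exhaust_2[of i] exhaust_2[of j]
    by (elim disjE) (simp_all add: su_def,
        (intro tendsto_Complex tendsto_vec_nth tendsto_minus assms)+)
qed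

lemma tendsto_matrix_mult:
  fixes A :: "complex^'n^'m" and B :: "complex^'p^'n"
  assumes "(f \<longlongrightarrow> A) F" "(g \<longlongrightarrow> B) F"
  shows "((\<lambda>x. f x ** g x) \<longlongrightarrow> A ** B) F"
  unfolding matrix_matrix_mult_def
  by (intro tendsto_vec_lambda tendsto_sum tendsto_mult tendsto_vec_nth assms)

lemma tendsto_conj_transpose:
  assumes "(f \<longlongrightarrow> A) F"
  shows "((\<lambda>x. conj_transpose (f x)) \<longlongrightarrow> conj_transpose A) F"
  unfolding conj_transpose_def
  by (intro tendsto_vec_lambda tendsto_cnj tendsto_vec_nth assms)

text \<open>Dividing by a square root of the determinant leaves a matrix of SU(2), whose second
  column is determined by the first.\<close>

lemma unitary_matrix_decomposition:
  assumes "unitary_matrix (U :: complex^2^2)"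
  obtains l w v where "norm l = 1" "w\<^sup>2 + v \<bullet> v = 1" "U = mat l ** su w v"
proof -
  define a b c d where "a = U$1$1" and "b = U$1$2" and "c = U$2$1" and "d = U$2$2"
  have U: "cnj a * a + cnj c * c = 1" "cnj a * b + cnj c * d = 0" "cnj b * b + cnj d * d = 1"
    using assms by (simp_all add: unitary_matrix_def conj_transpose_def vec_eq_iff forall_2
        matrix_matrix_mult_def sum_2 mat_def a_def b_def c_def d_def)
  define \<delta> where "\<delta> = a * d - b * c"
  \<comment> \<open>With \<open>\<delta>\<close> the determinant, orthonormality of the columns
    expresses the second column through the first.\<close>
  have d: "d = \<delta> * cnj a" using U(1,2) unfolding \<delta>_def by algebra
  have b: "b = - (\<delta> * cnj c)" using U(1,2) unfolding \<delta>_def by algebra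
  have "cnj \<delta> * \<delta> * (cnj a * a + cnj c * c) = 1"
    using U(3) unfolding d b by (simp add: algebra_simps)
  then have "\<delta> * cnj \<delta> = 1" using U(1) by (simp add: mult.commute)
  then have "of_real ((norm \<delta>)\<^sup>2) = (1 :: complex)"
    by (metis complex_norm_square)
  then have "(norm \<delta>)\<^sup>2 = 1" using of_real_eq_1_iff by blast
  then have n\<delta>: "norm \<delta> = 1" by (simp add: power2_eq_1_iff) (metis abs_norm_cancel abs_1 abs_minus)
  define l where "l = csqrt \<delta>"
  have ll: "l * l = \<delta>" by (metis l_def power2_csqrt power2_eq_square)
  have nl: "norm l = 1"
    using n\<delta> ll by (metis norm_csqrt l_def real_sqrt_one)
  have lc: "l * cnj l = 1" using nl by (simp flip: complex_norm_square)
  define a' c' where "a' = a * cnj l" and "c' = c * cnj l"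
  define v :: "real^3" where "v = vector [Im c', - Re c', Im a']"
  have "U = mat l ** su (Re a') v"
  proof -
    have "Complex (Re a') (v$3) = a'" "Complex (v$2) (v$1) = - cnj c'"
      "Complex (- v$2) (v$1) = c'" "Complex (Re a') (- v$3) = cnj a'"
      by (simp_all add: v_def complex_eq_iff)
    moreover have "a = l * a'" "c = l * c'" "b = - (l * cnj c')" "d = l * cnj a'"
      using lc b d ll by (simp_all add: a'_def c'_def mult_ac)
    ultimately show ?thesis
      by (simp add: su_def vec_eq_iff forall_2 matrix_matrix_mult_def sum_2 mat_def
          a_def b_def c_def d_def)
  qed
  moreover have "(Re a')\<^sup>2 + v \<bullet> v = 1"
  proof -
    have "cnj a' * a' + cnj c' * c' = (cnj a * a + cnj c * c) * (l * cnj l)"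
      by (simp add: a'_def c'_def algebra_simps)
    then have "cnj a' * a' + cnj c' * c' = 1" using U(1) lc by simp
    then have "Re (cnj a' * a' + cnj c' * c') = 1" by simp
    then show ?thesis
      by (simp add: v_def inner_vec_def sum_3 power2_eq_square algebra_simps)
  qed
  ultimately show ?thesis using nl that by blast
qed

text \<open>The preimage of \<open>G\<close> under \<open>su\<close> is a closed group of unit
  quaternions, and every unitary matrix is a scalar times a value of \<open>su\<close>. The
  hypothesis \<open>small\<close> may assume the group property of this preimage, so the small
  element can be constructed by quaternion arithmetic.\<close>

lemma closed_irreducible_subgroup_contains_unitary:
  fixes G :: "(complex^2^2) set"
  assumes closed: "closed G"
    and G_mult: "\<And>A B. A \<in> G \<Longrightarrow> B \<in> G \<Longrightarrow> A ** B \<in> G"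
    and inv: "\<And>A. A \<in> G \<Longrightarrow> conj_transpose A \<in> G"
    and scalar: "\<And>l. norm l = 1 \<Longrightarrow> mat l \<in> G"
    and small: "unit_quaternion_group {(w, v). w\<^sup>2 + v \<bullet> v = 1 \<and> su w v \<in> G} \<Longrightarrow>
      \<exists>w v. w\<^sup>2 + v \<bullet> v = 1 \<and> su w v \<in> G \<and> v \<noteq> 0 \<and> v \<bullet> v \<le> 1/4"
    and irreducible: "\<And>v. v \<noteq> 0 \<Longrightarrow> \<exists>w u. w\<^sup>2 + u \<bullet> u = 1 \<and> su w u \<in> G \<and> rot w u v \<times> v \<noteq> 0"
    and U: "unitary_matrix U"
  shows "U \<in> G"
proof -
  define K where "K = {(w, v). w\<^sup>2 + v \<bullet> v = 1 \<and> su w v \<in> G}"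
  have quat: "unit_quaternion_group K"
  proof
    show "closed K"
      unfolding closed_sequential_limits
    proof (intro allI impI, elim conjE)
      fix x :: "nat \<Rightarrow> real \<times> (real^3)" and l
      assume x: "\<forall>n. x n \<in> K" and l: "x \<longlonglongrightarrow> l"
      have x1: "(fst (x n))\<^sup>2 + snd (x n) \<bullet> snd (x n) = 1" "su (fst (x n)) (snd (x n)) \<in> G" for n
        using x by (auto simp: K_def split: prod.splits)
      have lim: "(\<lambda>n. fst (x n)) \<longlonglongrightarrow> fst l" "(\<lambda>n. snd (x n)) \<longlonglongrightarrow> snd l"
        using l by (auto intro: tendsto_fst tendsto_snd)
      have "(\<lambda>n. (fst (x n))\<^sup>2 + snd (x n) \<bullet> snd (x n)) \<longlonglongrightarrow> (fst l)\<^sup>2 + snd l \<bullet> snd l"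
        by (intro tendsto_intros lim)
      then have "(fst l)\<^sup>2 + snd l \<bullet> snd l = 1"
        using x1(1) by (simp add: LIMSEQ_const_iff)
      moreover have "su (fst l) (snd l) \<in> G"
        using closed_sequentially[OF closed x1(2) tendsto_su[OF lim]] .
      ultimately show "l \<in> K" by (auto simp: K_def split: prod.splits)
    qed
    show "w\<^sup>2 + v \<bullet> v = 1" if "(w, v) \<in> K" for w v using that by (simp add: K_def)
    have "su (-1) 0 = mat (-1)"
      by (simp add: su_def vec_eq_iff forall_2 mat_def complex_eq_iff)
    then show "(-1, 0) \<in> K" using scalar[of "-1"] by (simp add: K_def)
    show "(w, - v) \<in> K" if "(w, v) \<in> K" for w v
      using that inv[of "su w v"] by (simp add: K_def conj_transpose_su)
    show "(w * w' - v \<bullet> v', w *\<^sub>R v' + w' *\<^sub>R v - v \<times> v') \<in> K"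
      if "(w, v) \<in> K" "(w', v') \<in> K" for w v w' v'
    proof -
      define n where "n = v \<times> v'"
      have nn: "n \<bullet> n = (v \<bullet> v) * (v' \<bullet> v') - (v \<bullet> v')\<^sup>2"
        by (simp add: n_def dot_cross power2_eq_square inner_commute)
      have nv: "n \<bullet> v = 0" "n \<bullet> v' = 0" "v \<bullet> n = 0" "v' \<bullet> n = 0"
        by (simp_all add: n_def dot_cross_self)
      \<comment> \<open>The quaternion norm is multiplicative.\<close>
      have "(w * w' - v \<bullet> v')\<^sup>2 + (w *\<^sub>R v' + w' *\<^sub>R v - n) \<bullet> (w *\<^sub>R v' + w' *\<^sub>R v - n) =
          (w\<^sup>2 + v \<bullet> v) * (w'\<^sup>2 + v' \<bullet> v')"
        by (simp add: inner_add_left inner_add_right inner_diff_left inner_diff_right nn nv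
            inner_commute[of v' v] power2_eq_square algebra_simps)
      then show ?thesis using that G_mult[of "su w v" "su w' v'"] by (simp add: K_def su_mult n_def)
    qed
  qed
  interpret irreducible_quaternion_group K
    using quat irreducible
    by (auto simp: irreducible_quaternion_group_def irreducible_quaternion_group_axioms_def K_def)
  obtain w0 v0 where s: "(w0, v0) \<in> K" "v0 \<noteq> 0" "v0 \<bullet> v0 \<le> 1/4"
    using small quat by (auto simp: K_def)
  obtain l w v where *: "norm l = 1" "w\<^sup>2 + v \<bullet> v = 1" "U = mat l ** su w v"
    using unitary_matrix_decomposition[OF U] .
  then have "su w v \<in> G"
    using contains_unit_quaternions[OF s] by (auto simp: K_def)
  then show ?thesis using G_mult scalar * by simp
qed

section \<open>Small rotations in the image of the braid group\<close>

lemma cos_squared_small_angle: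
  assumes "0 < x" "x \<le> pi / 6"
  shows "3 / 4 \<le> (cos x)\<^sup>2" "(cos x)\<^sup>2 < 1"
proof -
  have "sin x \<le> sin (pi / 6)" using assms by (intro sin_monotone_2pi_le) auto
  then have "sin x \<le> 1 / 2" by (simp add: sin_30)
  moreover have pos: "sin x > 0" using assms by (intro sin_gt_zero) auto
  ultimately have "(sin x)\<^sup>2 \<le> (1 / 2)\<^sup>2" by (intro power_mono) auto
  then show "3 / 4 \<le> (cos x)\<^sup>2" "(cos x)\<^sup>2 < 1"
    using pos by (simp_all add: cos_squared_eq power_divide)
qed

text \<open>Three times the angle and twice the angle add up to a full turn, so their cosines agree.
  The resulting cubic has the root 1; the other factor is the claim.\<close>

lemma cos_2pi_5: "4 * (cos (2 * pi / 5))\<^sup>2 + 2 * cos (2 * pi / 5) = 1"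
proof -
  define c where "c = cos (2 * pi / 5)"
  have "cos (3 * (2 * pi / 5)) = cos (2 * (2 * pi / 5))"
    using cos_2pi_minus[of "2 * (2 * pi / 5)"] by (simp add: algebra_simps)
  then have "4 * c ^ 3 - 3 * c = 2 * c\<^sup>2 - 1"
    unfolding cos_treble_cos cos_double_cos c_def .
  then have "(c - 1) * (4 * c\<^sup>2 + 2 * c - 1) = 0"
    by (simp add: power3_eq_cube power2_eq_square algebra_simps)
  moreover have "c < cos 0" unfolding c_def by (intro cos_monotone_0_pi) auto
  ultimately show ?thesis by (simp add: c_def)
qed

text \<open>For odd \<open>n = k + 2 \<ge> 7\<close> a power of the first rotation has angle \<open>2 \<pi> / n\<close>, and for even
  \<open>n \<ge> 12\<close> its own angle \<open>4 \<pi> / n\<close> is small enough. In the cases \<open>n = 5\<close> and \<open>n = 8\<close> both rotations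
  have small order, but suitable words in them have a small angle.\<close>

lemma (in unit_quaternion_group) small_rotation_in_braid_image:
  fixes k :: nat
  defines "\<alpha> \<equiv> 2 * pi / (real k + 2)"
  assumes k: "k \<ge> 3" "k \<noteq> 4" "k \<noteq> 8"
    and ze: "norm z = 1" "z \<bullet> e = - cos \<alpha> / (1 + cos \<alpha>)"
    and A: "(cos \<alpha>, sin \<alpha> *\<^sub>R z) \<in> K" and B: "(cos \<alpha>, sin \<alpha> *\<^sub>R e) \<in> K"
  shows "\<exists>(w, v) \<in> K. v \<noteq> 0 \<and> v \<bullet> v \<le> 1/4"
proof -
  have "\<exists>w v. (w, v) \<in> K \<and> 3/4 \<le> w\<^sup>2 \<and> w\<^sup>2 < 1"
  proof -
    consider "k = 3" | "k = 6" | "odd k" "k \<ge> 5" | "k \<ge> 10"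
    proof -
      have "k = 3 \<or> k = 6 \<or> (odd k \<and> k \<ge> 5) \<or> k \<ge> 10" using k by presburger
      then show ?thesis using that by blast
    qed
    then show ?thesis
    proof cases
      case 1
      define c where "c = cos \<alpha>"
      have \<alpha>: "\<alpha> = 2 * pi / 5" by (simp add: \<alpha>_def 1)
      have c: "4 * c\<^sup>2 + 2 * c = 1" using cos_2pi_5 by (simp add: c_def \<alpha>)
      have c0: "c > 0" unfolding c_def \<alpha> by (intro cos_gt_zero) auto
      have "(sin \<alpha>)\<^sup>2 * (z \<bullet> e) = - ((1 - c) * c)"
      proof -
        have "(sin \<alpha>)\<^sup>2 = (1 - c) * (1 + c)"
          by (simp add: sin_squared_eq c_def power2_eq_square algebra_simps)
        then show ?thesis using c0 by (simp add: ze(2) c_def[symmetric])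
      qed
      \<comment> \<open>The word is the first double-braiding times the inverse of the second. It is
        close to a half-turn, so its square is close to -1.\<close>
      then have "cos \<alpha> * cos \<alpha> - (sin \<alpha> *\<^sub>R z) \<bullet> (- (sin \<alpha> *\<^sub>R e)) = 2 * c\<^sup>2 - c"
        by (simp add: c_def power2_eq_square algebra_simps)
      then obtain v where "(2 * c\<^sup>2 - c, v) \<in> K" using mult[OF A inv[OF B]] by auto
      then obtain v' where "(2 * (2 * c\<^sup>2 - c)\<^sup>2 - 1, v') \<in> K" using square by blast
      moreover have "2 * (2 * c\<^sup>2 - c)\<^sup>2 - 1 = 3/2 - 8 * c"
      proof -
        have "2 * c\<^sup>2 - c = 1/2 - 2 * c" using c by simp
        then have "2 * (2 * c\<^sup>2 - c)\<^sup>2 - 1 = 2 * (4 * c\<^sup>2 + 2 * c) - 8 * c - 1/2"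
          by (simp only:) (simp add: power2_eq_square algebra_simps)
        then show ?thesis by (simp add: c)
      qed
      moreover have "c < 5/16"
      proof (rule ccontr)
        assume "\<not> c < 5/16"
        then have "(5/16)\<^sup>2 \<le> c\<^sup>2" by (intro power_mono) auto
        then show False using c \<open>\<not> c < 5/16\<close> by (simp add: power2_eq_square)
      qed
      moreover have "c > 3/10"
      proof (rule ccontr)
        assume "\<not> c > 3/10"
        then have "c\<^sup>2 \<le> (3/10)\<^sup>2" using c0 by (intro power_mono) auto
        then show False using c \<open>\<not> c > 3/10\<close> by (simp add: power2_eq_square)
      qed
      moreover have "3/4 \<le> x\<^sup>2 \<and> x\<^sup>2 < 1" if "9/10 \<le> - x" "- x < 1" for x :: real
        using power_mono[OF that(1), of 2] power_strict_mono[OF that(2), of 2] that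
        by (simp add: power2_eq_square)
      ultimately show ?thesis by (intro exI[of _ "3/2 - 8 * c"] exI[of _ v']) auto
    next
      case 2
      define p where "p = cos \<alpha> / (1 + cos \<alpha>)"
      have \<alpha>: "\<alpha> = pi / 4" by (simp add: \<alpha>_def 2)
      have c: "(cos \<alpha>)\<^sup>2 = 1/2" "cos \<alpha> > 0" "sin \<alpha> = cos \<alpha>"
        by (simp_all add: \<alpha> cos_45 sin_45 power_divide)
      \<comment> \<open>For \<open>k = 6\<close> the squares of the generators are half-turns. Their
        product has scalar part \<open>p\<close>, and its cube is close to -1.\<close>
      have AB: "(0, (2 * cos \<alpha>) *\<^sub>R (sin \<alpha> *\<^sub>R z)) \<in> K" "(0, (2 * cos \<alpha>) *\<^sub>R (sin \<alpha> *\<^sub>R e)) \<in> K"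
        using square[OF A] square[OF B] c(1) by simp_all
      have "0 * 0 - ((2 * cos \<alpha>) *\<^sub>R (sin \<alpha> *\<^sub>R z)) \<bullet> ((2 * cos \<alpha>) *\<^sub>R (sin \<alpha> *\<^sub>R e)) = 
          4 * (cos \<alpha>)\<^sup>2 * (cos \<alpha>)\<^sup>2 * p"
        by (simp add: c(3) ze(2) p_def power2_eq_square)
      also have "\<dots> = p" by (simp add: c(1))
      finally obtain v where "(p, v) \<in> K" using mult[OF AB] by auto
      then obtain v' where v': "(4 * p ^ 3 - 3 * p, v') \<in> K" using cube by blast
      have p0: "p > 0" using c by (simp add: p_def)
      have "p * (1 + cos \<alpha>) = cos \<alpha>" using c by (simp add: p_def)
      then have "(1 - p) * cos \<alpha> = p" by (simp add: algebra_simps)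
      then have "(1 - p)\<^sup>2 * (cos \<alpha>)\<^sup>2 = p\<^sup>2" by (metis power_mult_distrib)
      \<comment> \<open>This quadratic relation reduces the cubic to \<open>17 * p - 8\<close>; the
        bounds 7/17 and 71/170 put that strictly between -1 and -9/10.\<close>
      then have pp: "p\<^sup>2 + 2 * p = 1" unfolding c(1) by (simp add: power2_eq_square algebra_simps)
      have "4 * p ^ 3 - 3 * p = p * (4 * p\<^sup>2 - 3)" by (simp add: power3_eq_cube power2_eq_square algebra_simps)
      also have "4 * p\<^sup>2 - 3 = 1 - 8 * p" using pp by simp
      also have "p * (1 - 8 * p) = 17 * p - 8" using pp by (simp add: power2_eq_square algebra_simps)
      finally have "(17 * p - 8, v') \<in> K" using v' by simp
      moreover have "p < 71/170"
      proof (rule ccontr)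
        assume "\<not> p < 71/170"
        then have "(71/170)\<^sup>2 \<le> p\<^sup>2" by (intro power_mono) auto
        then show False using pp \<open>\<not> p < 71/170\<close> by (simp add: power2_eq_square)
      qed
      moreover have "p > 7/17"
      proof (rule ccontr)
        assume "\<not> p > 7/17"
        then have "p\<^sup>2 \<le> (7/17)\<^sup>2" using p0 by (intro power_mono) auto
        then show False using pp \<open>\<not> p > 7/17\<close> by (simp add: power2_eq_square)
      qed
      moreover have "3/4 \<le> x\<^sup>2 \<and> x\<^sup>2 < 1" if "9/10 \<le> - x" "- x < 1" for x :: real
        using power_mono[OF that(1), of 2] power_strict_mono[OF that(2), of 2] that
        by (simp add: power2_eq_square)
      ultimately show ?thesis by (intro exI[of _ "17 * p - 8"] exI[of _ v']) auto
    next
      case 3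
      then obtain m where m: "k = 2 * m + 1" using oddE by blast
      \<comment> \<open>The exponent is half of \<open>k + 3\<close>, which makes the half-angle
        exceed \<open>pi\<close> by exactly \<open>pi / (k + 2)\<close>.\<close>
      have "real (m + 2) * \<alpha> = pi / (real k + 2) + pi"
        by (simp add: \<alpha>_def m field_simps)
      then have "(cos (pi / (real k + 2) + pi), sin (pi / (real k + 2) + pi) *\<^sub>R z) \<in> K"
        using power[OF A ze(1), of "m + 2"] by simp
      then obtain v where "(- cos (pi / (real k + 2)), v) \<in> K" by simp
      moreover have "0 < pi / (real k + 2)" "pi / (real k + 2) \<le> pi / 6"
        using 3 by (auto simp: field_simps)
      ultimately show ?thesis using cos_squared_small_angle[of "pi / (real k + 2)"]
        by (intro exI[of _ "- cos (pi / (real k + 2))"] exI[of _ v]) simp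
    next
      case 4
      then have "0 < \<alpha>" "\<alpha> \<le> pi / 6" by (auto simp: \<alpha>_def field_simps)
      then show ?thesis using A cos_squared_small_angle by blast
    qed
  qed
  then obtain w v where wv: "(w, v) \<in> K" "3/4 \<le> w\<^sup>2" "w\<^sup>2 < 1" by blast
  then have "v \<noteq> 0" "v \<bullet> v \<le> 1/4" using unit[OF wv(1)] by auto
  then show ?thesis using wv(1) by blast
qed

text \<open>A rotation that is not a half-turn can preserve only the line of its own axis. If both
  preserved the line of \<open>v\<close>, then \<open>z\<close> and \<open>e\<close> would be
  parallel unit vectors.\<close>

lemma rotations_have_no_common_axis:
  fixes z e v :: "real^3"
  assumes z: "norm z = 1" and e: "norm e = 1" and ze: "(z \<bullet> e)\<^sup>2 \<noteq> 1" and w: "w \<noteq> 0" "s \<noteq> 0"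
    and v: "v \<noteq> 0"
  shows "rot w (s *\<^sub>R z) v \<times> v \<noteq> 0 \<or> rot w (s *\<^sub>R e) v \<times> v \<noteq> 0"
proof (rule ccontr)
  assume "\<not> ?thesis"
  then have "(s *\<^sub>R z) \<times> v = 0" "(s *\<^sub>R e) \<times> v = 0"
    using rot_parallel_imp_parallel w by blast+
  then have zv: "z \<times> v = 0" and ev: "e \<times> v = 0" using w by (simp_all add: cross_mult_left)
  have zz: "z \<bullet> z = 1" and ee: "e \<bullet> e = 1" using z e by (simp_all add: norm_eq_1)
  have "z \<times> (z \<times> v) = (z \<bullet> v) *\<^sub>R z - v" using zz by (simp add: Lagrange)
  then have v': "v = (z \<bullet> v) *\<^sub>R z" using zv by simp
  then have "(z \<bullet> v) *\<^sub>R (e \<times> z) = 0" using ev by (metis cross_mult_right)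
  moreover have "z \<bullet> v \<noteq> 0" using v v' by auto
  ultimately have "e \<times> z = 0" by simp
  then have "(z \<bullet> e)\<^sup>2 = 1"
    using dot_cross[of e z e z] zz ee by (simp add: inner_commute power2_eq_square)
  then show False using ze by simp
qed


section \<open>Density\<close>

lemma U2_simps:
  "carrier U2 = {A. unitary_matrix A}" "A \<otimes>\<^bsub>U2\<^esub> B = A ** B" "\<one>\<^bsub>U2\<^esub> = mat 1"
  by (simp_all add: U2_def)

lemma inv_U2: "unitary_matrix A \<Longrightarrow> inv\<^bsub>U2\<^esub> A = conj_transpose A"
  by (rule group.inv_equality[OF group_U2])
    (simp_all add: U2_simps unitary_matrix_def conj_transpose_conj_transpose)

lemma matrix_inv_eqI:
  fixes A :: "'a :: comm_semiring_1 ^ 'n ^ 'n"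
  assumes "A ** B = mat 1" "B ** A = mat 1"
  shows "matrix_inv A = B"
proof -
  have "A ** matrix_inv A = mat 1 \<and> matrix_inv A ** A = mat 1"
    unfolding matrix_inv_def by (rule someI[of _ B]) (use assms in simp)
  then have "B ** (A ** matrix_inv A) = B" by simp
  then show ?thesis by (simp only: matrix_mul_assoc assms(2) matrix_mul_lid)
qed

lemma mat_mult_commute: "mat c ** A = A ** mat (c :: complex)"
  by (simp add: matrix_matrix_mult_def mat_def vec_eq_iff mult_delta_left mult_delta_right mult.commute)

lemma mat_mult_mat: "mat a ** mat b = (mat (a * b) :: complex^'n^'n)"
  by (simp add: matrix_matrix_mult_def mat_def vec_eq_iff mult_delta_left)

lemma mat_mult_left_commute: "X ** (mat b ** Y) = mat b ** (X ** Y)"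
  for X Y :: "complex^'n^'n"
  by (simp add: matrix_mul_assoc mat_mult_commute[of b X])

lemma mat_mult_scaled: "(mat a ** X) ** (mat b ** Y) = mat (a * b) ** (X ** Y)"
  for X Y :: "complex^'n^'n"
proof -
  have "(mat a ** X) ** (mat b ** Y) = mat a ** (X ** (mat b ** Y))"
    by (simp only: matrix_mul_assoc)
  also have "\<dots> = mat a ** mat b ** (X ** Y)"
    unfolding mat_mult_left_commute[of X] by (rule matrix_mul_assoc)
  finally show ?thesis by (simp only: mat_mult_mat)
qed

section \<open>The braiding matrices as unit quaternions\<close>

definition braid_angle :: "nat \<Rightarrow> real" where
  "braid_angle k = 2 * pi / (real k + 2)"

text \<open>The square is diagonal with entries \<open>qpow k (-3/2)\<close> and
  \<open>qpow k (1/2)\<close>. Taking out a square root of its determinant leaves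
  \<open>qpow k (-1)\<close> and \<open>qpow k 1\<close>, a rotation about the third axis with
  half-angle \<open>braid_angle k\<close>.\<close>

lemma R_matrix_squared:
  "R_matrix k ** R_matrix k =
    mat (qpow k (- 1/2)) ** su (cos (braid_angle k)) (sin (braid_angle k) *\<^sub>R (- axis 3 1))"
proof -
  have q: "qpow k (-1) = Complex (cos (braid_angle k)) (- sin (braid_angle k))"
    "qpow k 1 = Complex (cos (braid_angle k)) (sin (braid_angle k))"
    by (simp_all add: qpow_cis braid_angle_def complex_eq_iff)
  have "qpow k (-3/4) * qpow k (-3/4) = qpow k (-1/2) * qpow k (-1)"
    "qpow k (1/4) * qpow k (1/4) = qpow k (-1/2) * qpow k 1"
    by (simp_all flip: qpow_add)
  then show ?thesis unfolding q
    by (simp add: R_matrix_def su_def vec_eq_iff forall_2 matrix_matrix_mult_def sum_2 mat_def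
        axis_def complex_eq_iff)
qed

text \<open>F is a real combination of the Pauli matrices X and Z, and the factor
  \<open>- \<i>\<close> undoes the one inside \<open>su\<close>. Hence F acts as the half-turn about
  \<open>f\<close>.\<close>

lemma F_matrix_su:
  assumes "k \<ge> 3"
  obtains f where "F_matrix k = mat (- \<i>) ** su 0 f" "f \<bullet> f = 1"
    "(f \<bullet> axis 3 1)\<^sup>2 = 1 / (2 * (1 + cos (braid_angle k)))"
proof -
  define c where "c = 1 / (2 * cos (pi / (real k + 2)))"
  define s where "s = sqrt (1 + 2 * cos (2 * pi / (real k + 2))) * c"
  note F = F_matrix_real[OF assms, folded c_def, folded s_def]
  define f :: "real^3" where "f = vector [s, 0, - c]"
  have "F_matrix k = mat (- \<i>) ** su 0 f"
    unfolding F(1) by (simp add: f_def su_def vec_eq_iff forall_2 matrix_matrix_mult_def sum_2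
        mat_def complex_eq_iff)
  moreover have "f \<bullet> f = 1"
    using F(2) by (simp add: f_def inner_vec_def sum_3 power2_eq_square)
  moreover have "(f \<bullet> axis 3 1)\<^sup>2 = 1 / (2 * (1 + cos (braid_angle k)))"
  proof -
    have "f \<bullet> axis 3 1 = - c" by (simp add: f_def inner_axis)
    moreover have "1 + cos (braid_angle k) = 2 * (cos (pi / (real k + 2)))\<^sup>2"
      using cos_double_cos[of "pi / (real k + 2)"] by (simp add: braid_angle_def)
    ultimately show ?thesis by (simp add: c_def power_divide power_mult_distrib)
  qed
  ultimately show ?thesis using that by blast
qed

lemma su_one: "su 1 0 = mat 1"
  by (simp add: su_def vec_eq_iff forall_2 mat_def complex_eq_iff)

theorem theorem3p5:
  fixes k :: nat and \<rho> :: "braid3 \<Rightarrow> complex ^ 2 ^ 2"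
  assumes "k \<ge> 3" and "k \<noteq> 4" and "k \<noteq> 8"
    and "\<rho> \<in> hom B3 U2"
    and "\<rho> \<sigma>1 = R_matrix k"
    and "\<rho> \<sigma>2 = matrix_inv (F_matrix k) ** R_matrix k ** F_matrix k"
  shows "subtopology euclidean (carrier U2) closure_of
           generate U2 ({\<rho> (\<sigma>1 [^]\<^bsub>B3\<^esub> (2::nat)), \<rho> (\<sigma>2 [^]\<^bsub>B3\<^esub> (2::nat))} \<union> {mat l | l :: complex. norm l = 1})
         = carrier U2"
proof -
  define S where "S = {\<rho> (\<sigma>1 [^]\<^bsub>B3\<^esub> (2::nat)), \<rho> (\<sigma>2 [^]\<^bsub>B3\<^esub> (2::nat))} \<union>
    {mat l | l :: complex. norm l = 1}"
  define H where "H = generate U2 S"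
  \<comment> \<open>The closure is taken among all matrices; the unitary group is reinstated only at
    the end.\<close>
  define G where "G = closure H"
  define \<alpha> where "\<alpha> = braid_angle k"
  define z :: "real^3" where "z = - axis 3 1"
  obtain f where F: "F_matrix k = mat (- \<i>) ** su 0 f" and ff: "f \<bullet> f = 1"
    and fz: "(f \<bullet> axis 3 1)\<^sup>2 = 1 / (2 * (1 + cos \<alpha>))"
    using F_matrix_su[OF assms(1)] \<alpha>_def by metis
  \<comment> \<open>The half-turn given by F takes the axis \<open>z\<close> of the first
    double-braiding to the axis \<open>e\<close> of the second.\<close>
  define e where "e = rot 0 f z"
  have c0: "cos \<alpha> > 0"
    unfolding \<alpha>_def braid_angle_def using assms(1) by (intro cos_gt_zero) (auto simp: field_simps)
  have s0: "sin \<alpha> \<noteq> 0"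
    unfolding \<alpha>_def braid_angle_def using assms(1) sin_gt_zero[of "2 * pi / (real k + 2)"]
    by (auto simp: field_simps)
  have zz: "z \<bullet> z = 1" by (simp add: z_def inner_axis)
  have e: "e = - z + (2 * (f \<bullet> z)) *\<^sub>R f" by (simp add: e_def rot_def ff)
  have ee: "e \<bullet> e = 1"
    by (simp add: e inner_add_left inner_add_right zz ff inner_commute[of z f] algebra_simps)
  \<comment> \<open>The double-angle formula for the angle between \<open>f\<close> and
    \<open>z\<close>. Since \<open>cos \<alpha>\<close> is positive, the value lies strictly between
    -1 and 1, so the axes are distinct.\<close>
  have "z \<bullet> e = 2 * (f \<bullet> axis 3 1)\<^sup>2 - 1"
    by (simp add: e inner_diff_right zz inner_commute[of z f] power2_eq_square) (simp add: z_def)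
  then have ze: "z \<bullet> e = - cos \<alpha> / (1 + cos \<alpha>)"
    using c0 by (simp add: fz field_simps)
  have "\<bar>z \<bullet> e\<bar> < 1" using c0 by (simp add: ze)
  then have ze1: "(z \<bullet> e)\<^sup>2 \<noteq> 1" by (auto simp: power2_eq_1_iff)

  have hom: "\<rho> (x [^]\<^bsub>B3\<^esub> (2::nat)) = \<rho> x ** \<rho> x" for x
  proof -
    interpret group B3 by (rule group_B3)
    have "x \<in> carrier B3" by (simp add: B3_def)
    then have "\<rho> (x [^]\<^bsub>B3\<^esub> (2::nat)) = \<rho> (x \<otimes>\<^bsub>B3\<^esub> x)"
      by (simp add: numeral_2_eq_2)
    then show ?thesis using hom_mult[OF assms(4) \<open>x \<in> carrier B3\<close> \<open>x \<in> carrier B3\<close>]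
      by (simp add: U2_simps)
  qed
  have FF: "F_matrix k ** F_matrix k = mat 1"
  proof -
    have "F_matrix k ** F_matrix k = mat (-1) ** su (-1) 0"
      unfolding F by (simp add: mat_mult_scaled su_mult ff)
    also have "\<dots> = mat 1" using scalar_su[of "-1" "-1" 0] by (simp add: su_one)
    finally show ?thesis .
  qed
  have r1: "\<rho> (\<sigma>1 [^]\<^bsub>B3\<^esub> (2::nat)) = mat (qpow k (-1/2)) ** su (cos \<alpha>) (sin \<alpha> *\<^sub>R z)"
    using hom assms(5) R_matrix_squared by (simp add: \<alpha>_def z_def)
  have r2: "\<rho> (\<sigma>2 [^]\<^bsub>B3\<^esub> (2::nat)) = mat (qpow k (-1/2)) ** su (cos \<alpha>) (sin \<alpha> *\<^sub>R e)"
  proof -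
    let ?F = "F_matrix k" and ?R = "R_matrix k" and ?A = "su (cos \<alpha>) (sin \<alpha> *\<^sub>R z)"
    have "\<rho> (\<sigma>2 [^]\<^bsub>B3\<^esub> (2::nat)) = (?F ** ?R ** ?F) ** (?F ** ?R ** ?F)"
      using hom assms(6) matrix_inv_eqI[OF FF FF] by simp
    also have "\<dots> = ?F ** (?R ** ?R) ** ?F"
    proof -
      have "?F ** (?F ** X) = X" for X :: "complex^2^2" by (simp add: matrix_mul_assoc FF)
      then show ?thesis by (simp flip: matrix_mul_assoc)
    qed
    also have "\<dots> = mat (qpow k (-1/2)) ** (?F ** ?A ** ?F)"
      unfolding R_matrix_squared \<alpha>_def z_def
      by (simp add: mat_mult_left_commute[of ?F] flip: matrix_mul_assoc)
    \<comment> \<open>The two factors \<open>- \<i>\<close> contribute -1, which cancels the sign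
      from \<open>reflection_su\<close>.\<close>
    also have "?F ** ?A ** ?F = mat (-1) ** su (- cos \<alpha>) (- rot 0 f (sin \<alpha> *\<^sub>R z))"
      unfolding F by (simp add: mat_mult_scaled reflection_su[OF ff] flip: matrix_mul_assoc[of "mat (- \<i>)"])
    also have "\<dots> = su (cos \<alpha>) (sin \<alpha> *\<^sub>R e)"
      using scalar_su[of "-1" "- cos \<alpha>" "- rot 0 f (sin \<alpha> *\<^sub>R z)"]
      by (simp add: e_def rot_def algebra_simps)
    finally show ?thesis .
  qed

  have mat_unitary: "unitary_matrix (mat l :: complex^2^2)" if "norm l = 1" for l
  proof -
    have "l * cnj l = 1" using that by (simp flip: complex_norm_square)
    moreover have "conj_transpose (mat l) = (mat (cnj l) :: complex^2^2)"
      by (simp add: conj_transpose_def mat_def vec_eq_iff)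
    ultimately show ?thesis by (simp add: unitary_matrix_def mat_mult_mat mult.commute)
  qed
  have \<rho>_unitary: "\<rho> x \<in> carrier U2" for x
    using assms(4) by (auto simp: hom_def B3_def)
  then have S: "S \<subseteq> carrier U2" using mat_unitary by (auto simp: S_def U2_simps)
  interpret U2: group U2 by (rule group_U2)
  have HU: "H \<subseteq> carrier U2" unfolding H_def by (rule U2.generate_incl[OF S])
  have H_mult: "A ** B \<in> H" if "A \<in> H" "B \<in> H" for A B
    using generate.eng[of A U2 S B] that by (simp add: H_def U2_simps)
  have H_inv: "conj_transpose A \<in> H" if "A \<in> H" for A
    using U2.generate_m_inv_closed[OF S, of A] that HU inv_U2[of A] by (auto simp: H_def U2_simps)
  have SG: "A \<in> G" if "A \<in> S" for A
    using generate.incl[OF that, of U2] closure_subset unfolding G_def H_def by blast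
  have G_mult: "A ** B \<in> G" if AB: "A \<in> G" "B \<in> G" for A B
  proof -
    obtain x y where "\<forall>n. x n \<in> H" "x \<longlonglongrightarrow> A" "\<forall>n. y n \<in> H" "y \<longlonglongrightarrow> B"
      using AB unfolding G_def closure_sequential by blast
    then show ?thesis unfolding G_def closure_sequential
      by (intro exI[of _ "\<lambda>n. x n ** y n"]) (simp add: H_mult tendsto_matrix_mult)
  qed
  have G_inv: "conj_transpose A \<in> G" if A: "A \<in> G" for A
  proof -
    obtain x where "\<forall>n. x n \<in> H" "x \<longlonglongrightarrow> A"
      using A unfolding G_def closure_sequential by blast
    then show ?thesis unfolding G_def closure_sequential
      by (intro exI[of _ "\<lambda>n. conj_transpose (x n)"]) (simp add: H_inv tendsto_conj_transpose)
  qed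
  have scalar: "mat l \<in> G" if "norm l = 1" for l
    using SG that by (auto simp: S_def)
  \<comment> \<open>Unit scalars lie in \<open>G\<close>, so the factor \<open>qpow k (-1/2)\<close>
    of a double-braiding can be removed.\<close>
  have descale: "X \<in> G" if "mat (qpow k (-1/2)) ** X \<in> G" for X
  proof -
    have "mat (qpow k (1/2)) ** (mat (qpow k (-1/2)) ** X) = X"
      by (simp add: matrix_mul_assoc mat_mult_mat flip: qpow_add) (simp add: qpow_cis)
    moreover have "norm (qpow k (1/2)) = 1" by (simp add: qpow_cis)
    ultimately show ?thesis using G_mult[OF scalar that] by metis
  qed
  have A: "su (cos \<alpha>) (sin \<alpha> *\<^sub>R z) \<in> G" and B: "su (cos \<alpha>) (sin \<alpha> *\<^sub>R e) \<in> G"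
    using descale SG r1 r2 by (auto simp: S_def)
  have unit: "(cos \<alpha>)\<^sup>2 + (sin \<alpha> *\<^sub>R z) \<bullet> (sin \<alpha> *\<^sub>R z) = 1" "(cos \<alpha>)\<^sup>2 + (sin \<alpha> *\<^sub>R e) \<bullet> (sin \<alpha> *\<^sub>R e) = 1"
    by (simp_all add: zz ee flip: power2_eq_square)
  have "U \<in> G" if "unitary_matrix U" for U
  proof (rule closed_irreducible_subgroup_contains_unitary[OF _ G_mult G_inv scalar _ _ that])
    show "closed G" by (simp add: G_def)
    show "\<exists>w v. w\<^sup>2 + v \<bullet> v = 1 \<and> su w v \<in> G \<and> v \<noteq> 0 \<and> v \<bullet> v \<le> 1 / 4"
      if "unit_quaternion_group {(w, v). w\<^sup>2 + v \<bullet> v = 1 \<and> su w v \<in> G}"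
      using unit_quaternion_group.small_rotation_in_braid_image[OF that assms(1-3), folded braid_angle_def,
          folded \<alpha>_def, of z e] zz ze A B unit
      by (auto simp: norm_eq_1)
    show "\<exists>w u. w\<^sup>2 + u \<bullet> u = 1 \<and> su w u \<in> G \<and> rot w u v \<times> v \<noteq> 0" if "v \<noteq> 0" for v
      using rotations_have_no_common_axis[of z e "cos \<alpha>" "sin \<alpha>" v] zz ee ze1 c0 s0 that A B unit
      by (metis norm_eq_1 less_irrefl)
  qed
  then have "carrier U2 \<subseteq> closure H" by (auto simp: U2_simps G_def)
  then have "subtopology euclidean (carrier U2) closure_of H = carrier U2"
    using HU by (simp add: closure_of_subtopology Int_absorb1 Int_absorb2)
  then show ?thesis by (simp add: H_def S_def)
qed

end
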